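(* Let $n\ge 2$ and $R=\mathbb{Z}[t_1^{\pm1},\dots,t_n^{\pm1}]$. The linear representation $\widehat{\rho}_G : Cb_n \to \mathrm{GL}_n(R)$ is an extension of the Gassner representation $\rho_G: P_n\to \mathrm{GL}_n(R)$ of the pure braid group; that is, viewing $P_n$ as a subgroup of $Cb_n\le \mathrm{Aut}(F_n)$, the restriction of $\widehat{\rho}_G$ to $P_n$ equals $\rho_G$.
   Context: $F_n$ is the free group with free basis $x_1,\dots,x_n$. Automorphisms act on the right, so in a product $\alpha\beta$ the automorphism $\alpha$ is applied first: $x^{\alpha\beta}=(x^\alpha)^\beta$. $Cb_n$ is the group of basis-conjugating automorphisms of $F_n$: automorphisms sending each $x_i$ to $f_i^{-1}x_if_i$ for some $f_i\in F_n$. It is generated (McCool) by $\varepsilon_{ij}$, $1\le i\ne j\le n$, where $\varepsilon_{ij}$ maps $x_i\mapsto x_j^{-1}x_ix_j$ and $x_l\mapsto x_l$ for $l\ne i$. The braid group $B_n$ (generators $\sigma_1,\dots,\sigma_{n-1}$, relations $\sigma_i\sigma_{i+1}\sigma_i=\sigma_{i+1}\sigma_i\sigma_{i+1}$ and $\sigma_i\sigma_j=\sigma_j\sigma_i$ for $|i-j|\ge2$) is embedded in $\mathrm{Aut}(F_n)$ by letting $\sigma_i$ act as $x_i\mapsto x_ix_{i+1}x_i^{-1}$, $x_{i+1}\mapsto x_i$, $x_l\mapsto x_l$ for $l\ne i,i+1$. The pure braid group $P_n$ is the kernel of $B_n\to S_n$, $\sigma_i\mapsto(i,i+1)$; under the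 embedding $P_n\le Cb_n$. Fox derivatives $\partial/\partial x_j:\mathbb{Z}F_n\to\mathbb{Z}F_n$ are the additive maps with $\partial x_i/\partial x_j=\delta_{ij}$ and $\partial(wv)/\partial x_j=(\partial w/\partial x_j)\,v^\tau+w\,\partial v/\partial x_j$, where $\tau:\mathbb{Z}F_n\to\mathbb{Z}$ is the augmentation. Let $\varphi$ be the homomorphism from $F_n$ onto the free abelian group with basis $t_1,\dots,t_n$, $x_i\mapsto t_i$, extended to $\mathbb{Z}F_n\to R$. The Gassner representation is $\rho_G(\alpha)=\left[\left(\partial(x_i^\alpha)/\partial x_j\right)^\varphi\right]_{i,j=1}^n$ for $\alpha\in P_n$. $\widehat{\rho}_G$ is the restriction to $Cb_n$ of the Magnus representation $\rho$ of the group $\mathrm{IA}(F_n)$ (automorphisms of $F_n$ acting trivially on the abelianization), $\rho(\alpha)=\left[\left(\partial(x_i^\alpha)/\partial x_j\right)^\varphi\right]_{i,j=1}^n$. Matrices act from the right on the free left $R$-module with basis $e_1,\dots,e_n$ (so $e_iM$ is the $i$-th row of $M$). On generators, $e_i\,\widehat{\rho}_G(\varepsilon_{ij})=t_j^{-1}(t_i-1)e_j+t_j^{-1}e_i$ and $e_l\,\widehat{\rho}_G(\varepsilon_{ij})=e_l$ for $l\ne i$. *)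

theory Defs
  imports
    "HOL-Algebra.Sym_Groups"
    "HOL-Algebra.Bij"
    "HOL-Algebra.Free_Abelian_Groups"
    "Jordan_Normal_Form.Matrix"
begin

section \<open>Free groups\<close>

text \<open>
  Elements of the free group are words in the letters \<open>(i, True)\<close> (the generator \<open>x\<^sub>i\<close>) and
  \<open>(i, False)\<close> (its inverse), modulo cancellation. The type is an instance of the (not necessarily
  commutative) class \<open>group_add\<close>, i.e. the group law is written additively: only in this way does
  the convolution product of \<open>'a fgroup \<Rightarrow>\<^sub>0 int\<close> make that type the integral group ring.
\<close>

inductive cancel_step :: "('a \<times> bool) list \<Rightarrow> ('a \<times> bool) list \<Rightarrow> bool" where
  "cancel_step (u @ (i, b) # (i, \<not> b) # v) (u @ v)"

quotient_type 'a fgroup = "('a \<times> bool) list" / "equivclp cancel_step"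
  by simp

lemma equivclp_image:
  assumes "equivclp r x y" and "\<And>x y. r x y \<Longrightarrow> s (f x) (f y)"
  shows "equivclp s (f x) (f y)"
  using assms(1)
proof induction
  case (step y z)
  then have "equivclp s (f y) (f z)"
    using assms(2) by (metis r_into_equivclp equivclp_sym)
  with step.IH show ?case by (rule equivclp_trans)
qed simp

lemma cancel_append_left: "cancel_step u v \<Longrightarrow> cancel_step (w @ u) (w @ v)"
  by (erule cancel_step.cases) (metis append.assoc cancel_step.intros)

lemma cancel_append_right: "cancel_step u v \<Longrightarrow> cancel_step (u @ w) (v @ w)"
  by (erule cancel_step.cases) (metis append.assoc append_Cons cancel_step.intros)

definition word_inv :: "('a \<times> bool) list \<Rightarrow> ('a \<times> bool) list"
  where "word_inv w = rev (map (\<lambda>(i, b). (i, \<not> b)) w)"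

lemma cancel_word_inv: "cancel_step u v \<Longrightarrow> cancel_step (word_inv u) (word_inv v)"
proof (erule cancel_step.cases)
  fix p i b q assume uv: "u = p @ (i, b) # (i, \<not> b) # q" "v = p @ q"
  show "cancel_step (word_inv u) (word_inv v)"
    using cancel_step.intros[of "word_inv q" i b "word_inv p"] by (simp add: uv word_inv_def)
qed

lemma word_inv_cancels: "equivclp cancel_step (word_inv w @ w) []"
proof (induction w)
  case (Cons a w)
  obtain i b where a: "a = (i, b)" by fastforce
  have "cancel_step (word_inv (a # w) @ a # w) (word_inv w @ w)"
    using cancel_step.intros[of "word_inv w" i "\<not> b" w] by (simp add: a word_inv_def)
  with Cons show ?case by (meson equivclp_trans r_into_equivclp)
qed (simp add: word_inv_def)

instantiation fgroup :: (type) group_add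
begin

lift_definition zero_fgroup :: "'a fgroup" is "[]" .

lift_definition plus_fgroup :: "'a fgroup \<Rightarrow> 'a fgroup \<Rightarrow> 'a fgroup" is "(@)"
proof -
  fix u u' v v' :: "('a \<times> bool) list"
  assume "equivclp cancel_step u u'" "equivclp cancel_step v v'"
  then have "equivclp cancel_step (u @ v) (u' @ v)" "equivclp cancel_step (u' @ v) (u' @ v')"
    by (auto elim!: equivclp_image[where f = "\<lambda>x. x @ v"] equivclp_image[where f = "\<lambda>x. u' @ x"]
        intro: cancel_append_left cancel_append_right)
  then show "equivclp cancel_step (u @ v) (u' @ v')" by (rule equivclp_trans)
qed

lift_definition uminus_fgroup :: "'a fgroup \<Rightarrow> 'a fgroup" is word_inv
  by (erule equivclp_image) (rule cancel_word_inv)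

definition minus_fgroup :: "'a fgroup \<Rightarrow> 'a fgroup \<Rightarrow> 'a fgroup"
  where "minus_fgroup a b = a + - b"

instance
proof
  fix a b c :: "'a fgroup"
  show "a + b + c = a + (b + c)" by transfer simp
  show "0 + a = a" by transfer simp
  show "a + 0 = a" by transfer simp
  show "- a + a = 0" by transfer (rule word_inv_cancels)
  show "a + - b = a - b" by (simp add: minus_fgroup_def)
qed

end

lift_definition gen :: "'a \<Rightarrow> 'a fgroup" is "\<lambda>i. [(i, True)]" .

definition free_group :: "'a set \<Rightarrow> 'a fgroup monoid"
  where "free_group S = \<lparr>carrier = abs_fgroup ` lists (S \<times> UNIV), mult = (+), one = 0\<rparr>"

text \<open>The homomorphism from the free group on \<open>S\<close> to \<open>G\<close> with \<open>x\<^sub>i \<mapsto> f i\<close> for \<open>i \<in> S\<close>.\<close>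

definition free_lift :: "'a set \<Rightarrow> ('b, 'c) monoid_scheme \<Rightarrow> ('a \<Rightarrow> 'b) \<Rightarrow> 'a fgroup \<Rightarrow> 'b"
  where "free_lift S G f =
    (THE h. h \<in> hom (free_group S) G \<inter> extensional (carrier (free_group S))
            \<and> (\<forall>i\<in>S. h (gen i) = f i))"

lemma abs_fgroup_append: "abs_fgroup (u @ v) = abs_fgroup u + abs_fgroup v"
  by (simp add: plus_fgroup.abs_eq)

lemma abs_fgroup_Nil: "abs_fgroup [] = 0"
  by (simp add: zero_fgroup.abs_eq)

lemma abs_fgroup_letter: "abs_fgroup [(i, b)] = (if b then gen i else - gen i)"
  by (simp add: gen.abs_eq uminus_fgroup.abs_eq word_inv_def)

lemma abs_fgroup_Cons:
  "abs_fgroup ((i, b) # u) = (if b then gen i else - gen i) + abs_fgroup u"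
  using abs_fgroup_append[of "[(i, b)]" u] by (simp add: abs_fgroup_letter)

lemma mult_free_group [simp]: "x \<otimes>\<^bsub>free_group S\<^esub> y = x + y"
  and one_free_group [simp]: "\<one>\<^bsub>free_group S\<^esub> = 0"
  by (simp_all add: free_group_def)

lemma zero_in_free_group [simp]: "0 \<in> carrier (free_group S)"
  by (auto simp: free_group_def abs_fgroup_Nil[symmetric])

lemma gen_in_free_group [simp]: "i \<in> S \<Longrightarrow> gen i \<in> carrier (free_group S)"
  unfolding free_group_def gen.abs_eq by simp

lemma add_in_free_group [simp]:
  "u \<in> carrier (free_group S) \<Longrightarrow> v \<in> carrier (free_group S) \<Longrightarrow> u + v \<in> carrier (free_group S)"
proof -
  have "abs_fgroup (u @ v) \<in> abs_fgroup ` lists (S \<times> UNIV)"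
    if "u \<in> lists (S \<times> UNIV)" "v \<in> lists (S \<times> UNIV)" for u v :: "('a \<times> bool) list"
    using that by (intro imageI) auto
  then show "u + v \<in> carrier (free_group S)"
    if "u \<in> carrier (free_group S)" "v \<in> carrier (free_group S)"
    using that by (auto simp: free_group_def abs_fgroup_append simp del: in_lists_conv_set)
qed

lemma uminus_in_free_group [simp]:
  assumes "u \<in> carrier (free_group S)" shows "- u \<in> carrier (free_group S)"
proof -
  obtain w where w: "u = abs_fgroup w" "w \<in> lists (S \<times> UNIV)"
    using assms by (auto simp: free_group_def)
  from w(2) have "word_inv w \<in> lists (S \<times> UNIV)"
    by (auto simp: word_inv_def in_lists_conv_set)
  then show ?thesis
    unfolding free_group_def w(1) uminus_fgroup.abs_eq by simp
qed

lemma group_free_group: "group (free_group S)"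
proof (rule groupI)
  fix x assume "x \<in> carrier (free_group S)"
  then show "\<exists>y\<in>carrier (free_group S). y \<otimes>\<^bsub>free_group S\<^esub> x = \<one>\<^bsub>free_group S\<^esub>"
    by (intro bexI[of _ "- x"]) simp_all
qed (simp_all add: add.assoc)

lemma inv_free_group [simp]:
  "u \<in> carrier (free_group S) \<Longrightarrow> inv\<^bsub>free_group S\<^esub> u = - u"
  by (rule group.inv_equality[OF group_free_group]) simp_all

lemma free_group_induct [consumes 1, case_names zero gen inv]:
  assumes "w \<in> carrier (free_group S)"
    and "P 0"
    and "\<And>i u. i \<in> S \<Longrightarrow> u \<in> carrier (free_group S) \<Longrightarrow> P u \<Longrightarrow> P (gen i + u)"
    and "\<And>i u. i \<in> S \<Longrightarrow> u \<in> carrier (free_group S) \<Longrightarrow> P u \<Longrightarrow> P (- gen i + u)"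
  shows "P w"
proof -
  have "P (abs_fgroup l)" if "l \<in> lists (S \<times> UNIV)" for l
    using that
  proof (induction l)
    case Nil
    then show ?case using assms(2) by (simp add: abs_fgroup_Nil)
  next
    case (Cons a l)
    obtain i b where "a = (i, b)" by fastforce
    moreover have "abs_fgroup l \<in> carrier (free_group S)"
      using Cons by (auto simp: free_group_def)
    ultimately show ?case
      using Cons assms(3,4)[of i "abs_fgroup l"] by (cases b) (auto simp: abs_fgroup_Cons)
  qed
  with assms(1) show ?thesis by (auto simp: free_group_def)
qed

fun word_eval :: "('b, 'c) monoid_scheme \<Rightarrow> ('a \<Rightarrow> 'b) \<Rightarrow> ('a \<times> bool) list \<Rightarrow> 'b" where
  "word_eval G f [] = \<one>\<^bsub>G\<^esub>"
| "word_eval G f ((i, b) # w) = (if b then f i else inv\<^bsub>G\<^esub> f i) \<otimes>\<^bsub>G\<^esub> word_eval G f w"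

context group
begin

lemma word_eval_closed: "range f \<subseteq> carrier G \<Longrightarrow> word_eval G f w \<in> carrier G"
proof (induction w)
  case (Cons a w)
  then show ?case by (cases a) (auto simp: image_subset_iff)
qed simp

lemma word_eval_append:
  assumes "range f \<subseteq> carrier G"
  shows "word_eval G f (u @ v) = word_eval G f u \<otimes> word_eval G f v"
proof (induction u)
  case (Cons a u)
  have "f i \<in> carrier G" for i using assms by auto
  with Cons show ?case
    by (cases a) (simp add: word_eval_closed assms m_assoc)
qed (simp add: word_eval_closed assms)

lemma word_eval_cancel:
  assumes "equivclp cancel_step u v" "range f \<subseteq> carrier G"
  shows "word_eval G f u = word_eval G f v"
proof -
  have f: "f i \<in> carrier G" for i using assms by auto
  have "word_eval G f u = word_eval G f v" if "cancel_step u v" for u v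
    using that
  proof cases
    case (1 p i b q)
    have "word_eval G f ((i, b) # (i, \<not> b) # q) = word_eval G f q"
      by (simp add: m_assoc[symmetric] f word_eval_closed assms)
    then show ?thesis by (simp add: 1 word_eval_append assms)
  qed
  with assms(1) show ?thesis
    by (induction rule: equivclp_induct) force+
qed

lemma free_lift_ex1:
  assumes f: "f \<in> S \<rightarrow> carrier G"
  shows "\<exists>!h. h \<in> hom (free_group S) G \<inter> extensional (carrier (free_group S))
               \<and> (\<forall>i\<in>S. h (gen i) = f i)"
proof (rule ex_ex1I)
  define f' where "f' = (\<lambda>i. if i \<in> S then f i else \<one>)"
  have f': "range f' \<subseteq> carrier G" using f by (auto simp: f'_def)
  define h where "h = (\<lambda>w\<in>carrier (free_group S). word_eval G f' (rep_fgroup w))"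
  have h: "h (abs_fgroup u) = word_eval G f' u" if "abs_fgroup u \<in> carrier (free_group S)" for u
  proof -
    have "equivclp cancel_step (rep_fgroup (abs_fgroup u)) u"
      by (simp add: Quotient3_fgroup rep_abs_rsp_left)
    from word_eval_cancel[OF this f'] that show ?thesis by (simp add: h_def)
  qed
  have carr: "x \<in> carrier (free_group S) \<Longrightarrow> \<exists>u. x = abs_fgroup u" for x
    by (auto simp: free_group_def)
  have "h \<in> hom (free_group S) G"
  proof (rule homI)
    fix x assume "x \<in> carrier (free_group S)"
    then show "h x \<in> carrier G" by (simp add: h_def word_eval_closed f')
  next
    fix x y assume xy: "x \<in> carrier (free_group S)" "y \<in> carrier (free_group S)"
    then obtain u v where uv: "x = abs_fgroup u" "y = abs_fgroup v" using carr by blast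
    have "abs_fgroup (u @ v) \<in> carrier (free_group S)"
      using xy by (simp add: uv abs_fgroup_append)
    from h[OF this] h[of u] h[of v] xy
    show "h (x \<otimes>\<^bsub>free_group S\<^esub> y) = h x \<otimes> h y"
      by (simp add: uv abs_fgroup_append[symmetric] word_eval_append f')
  qed
  moreover have "h (gen i) = f i" if "i \<in> S" for i
    using h[of "[(i, True)]"] that f
    by (auto simp: abs_fgroup_letter f'_def Pi_iff)
  ultimately show "\<exists>h. h \<in> hom (free_group S) G \<inter> extensional (carrier (free_group S))
               \<and> (\<forall>i\<in>S. h (gen i) = f i)"
    by (intro exI[of _ h]) (auto simp: h_def)
next
  fix h k
  assume h: "h \<in> hom (free_group S) G \<inter> extensional (carrier (free_group S))
               \<and> (\<forall>i\<in>S. h (gen i) = f i)"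
    and k: "k \<in> hom (free_group S) G \<inter> extensional (carrier (free_group S))
               \<and> (\<forall>i\<in>S. k (gen i) = f i)"
  interpret h: group_hom "free_group S" G h
    using h by (auto intro!: group_hom.intro group_hom_axioms.intro group_free_group)
  interpret k: group_hom "free_group S" G k
    using k by (auto intro!: group_hom.intro group_hom_axioms.intro group_free_group)
  have "h w = k w" if "w \<in> carrier (free_group S)" for w
    using that
  proof (induction w rule: free_group_induct)
    case zero
    show ?case using h.hom_one k.hom_one by simp
  next
    case (gen i u)
    then show ?case using h k h.hom_mult[of "gen i" u] k.hom_mult[of "gen i" u] by simp
  next
    case (inv i u)
    have "h (- gen i) = k (- gen i)"
      using h k h.hom_inv[of "gen i"] k.hom_inv[of "gen i"] inv by simp
    then show ?case using inv h.hom_mult[of "- gen i" u] k.hom_mult[of "- gen i" u] by simp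
  qed
  with h k show "h = k" by (metis IntE extensionalityI)
qed

lemma free_lift:
  assumes "f \<in> S \<rightarrow> carrier G"
  shows free_lift_hom: "free_lift S G f \<in> hom (free_group S) G"
    and free_lift_extensional: "free_lift S G f \<in> extensional (carrier (free_group S))"
    and free_lift_gen: "i \<in> S \<Longrightarrow> free_lift S G f (gen i) = f i"
  using theI'[OF free_lift_ex1[OF assms]] by (auto simp: free_lift_def)

end


section \<open>Group rings and Fox derivatives\<close>

text \<open>
  For a group \<open>G\<close> whose law is the \<open>+\<close> of its type, this is the carrier of the integral group ring of
  \<open>G\<close>; the ring operations are those of \<open>\<Rightarrow>\<^sub>0\<close>, and \<open>frag_of g\<close> is the group element \<open>g\<close>.
\<close>

definition group_ring :: "('g, 'b) monoid_scheme \<Rightarrow> ('g \<Rightarrow>\<^sub>0 int) set"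
  where "group_ring G = {a. Poly_Mapping.keys a \<subseteq> carrier G}"

definition augmentation :: "('g \<Rightarrow>\<^sub>0 int) \<Rightarrow> int"
  where "augmentation a = (\<Sum>g\<in>Poly_Mapping.keys a. Poly_Mapping.lookup a g)"

abbreviation F :: "nat \<Rightarrow> nat fgroup monoid"
  where "F n \<equiv> free_group {1..n}"

definition is_fox_derivative :: "nat \<Rightarrow> nat \<Rightarrow> ((nat fgroup \<Rightarrow>\<^sub>0 int) \<Rightarrow> (nat fgroup \<Rightarrow>\<^sub>0 int)) \<Rightarrow> bool"
  where "is_fox_derivative n j D \<longleftrightarrow>
    D \<in> group_ring (F n) \<rightarrow>\<^sub>E group_ring (F n) \<and>
    (\<forall>a\<in>group_ring (F n). \<forall>b\<in>group_ring (F n). D (a + b) = D a + D b) \<and>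
    (\<forall>i\<in>{1..n}. D (frag_of (gen i)) = (if i = j then 1 else 0)) \<and>
    (\<forall>a\<in>group_ring (F n). \<forall>b\<in>group_ring (F n).
       D (a * b) = D a * of_int (augmentation b) + a * D b)"

definition fox :: "nat \<Rightarrow> nat \<Rightarrow> (nat fgroup \<Rightarrow>\<^sub>0 int) \<Rightarrow> (nat fgroup \<Rightarrow>\<^sub>0 int)"
  where "fox n j = (THE D. is_fox_derivative n j D)"

lemma frag_of_add: "frag_of (u + v) = frag_of u * frag_of v" for u v :: "'g :: monoid_add"
  by (simp add: mult_single)

lemma frag_of_zero: "frag_of (0 :: 'g :: monoid_add) = 1"
  by simp

lemma augmentation_superset:
  assumes "finite A" "Poly_Mapping.keys a \<subseteq> A"
  shows "augmentation a = (\<Sum>g\<in>A. Poly_Mapping.lookup a g)"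
  unfolding augmentation_def
  by (rule sum.mono_neutral_left) (use assms in \<open>auto simp: in_keys_iff\<close>)

lemma augmentation_diff: "augmentation (a - b) = augmentation a - augmentation b"
proof -
  let ?A = "Poly_Mapping.keys a \<union> Poly_Mapping.keys b"
  have "augmentation x = (\<Sum>g\<in>?A. Poly_Mapping.lookup x g)" if "Poly_Mapping.keys x \<subseteq> ?A" for x
    by (rule augmentation_superset) (use that in auto)
  from this[of a] this[of b] this[of "a - b"] show ?thesis
    by (simp add: keys_diff lookup_minus sum_subtractf)
qed

lemma augmentation_frag_of [simp]: "augmentation (frag_of g) = 1"
  by (simp add: augmentation_def)

lemma group_ring_free_group:
  shows group_ring_zero: "0 \<in> group_ring (free_group S)"
    and group_ring_frag_of: "w \<in> carrier (free_group S) \<Longrightarrow> frag_of w \<in> group_ring (free_group S)"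
    and group_ring_diff: "a \<in> group_ring (free_group S) \<Longrightarrow> b \<in> group_ring (free_group S) \<Longrightarrow>
          a - b \<in> group_ring (free_group S)"
    and group_ring_add: "a \<in> group_ring (free_group S) \<Longrightarrow> b \<in> group_ring (free_group S) \<Longrightarrow>
          a + b \<in> group_ring (free_group S)"
    and group_ring_mult: "a \<in> group_ring (free_group S) \<Longrightarrow> b \<in> group_ring (free_group S) \<Longrightarrow>
          a * b \<in> group_ring (free_group S)"
  using keys_diff[of a b] Poly_Mapping.keys_add[of a b] keys_mult[of a b]
  unfolding group_ring_def by (simp, simp, blast, blast, force)

fun fox_word :: "'a \<Rightarrow> ('a \<times> bool) list \<Rightarrow> ('a fgroup \<Rightarrow>\<^sub>0 int)" where
  "fox_word j [] = 0"
| "fox_word j ((i, b) # w) =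
     (if i = j then (if b then 1 else - frag_of (- gen i)) else 0)
     + frag_of (if b then gen i else - gen i) * fox_word j w"

lemma fox_word_append: "fox_word j (u @ v) = fox_word j u + frag_of (abs_fgroup u) * fox_word j v"
proof (induction u)
  case (Cons a u)
  obtain i b where a: "a = (i, b)" by fastforce
  show ?case
    by (simp add: a Cons abs_fgroup_Cons frag_of_add distrib_left mult.assoc add.assoc)
qed (simp add: abs_fgroup_Nil)

lemma fox_word_cancel:
  assumes "equivclp cancel_step u v" shows "fox_word j u = fox_word j v"
proof -
  have *: "fox_word j u = fox_word j v" if "cancel_step u v" for u v
    using that
  proof cases
    case (1 p i b q)
    have "fox_word j ((i, b) # (i, \<not> b) # q) = fox_word j q"
      by (simp add: distrib_left mult.assoc[symmetric] frag_of_add[symmetric] del: mult_single)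
    then show ?thesis by (simp add: 1 fox_word_append)
  qed
  from assms show ?thesis
    by (induction rule: equivclp_induct) (metis *)+
qed

lemma fox_word_closed: "u \<in> lists (S \<times> UNIV) \<Longrightarrow> fox_word j u \<in> group_ring (free_group S)"
proof (induction u)
  case (Cons a u)
  obtain i b where a: "a = (i, b)" by fastforce
  have i: "i \<in> S" using Cons by (simp add: a)
  have "- frag_of (- gen i) \<in> group_ring (free_group S)" "1 \<in> group_ring (free_group S)"
    using i by (auto simp: group_ring_def)
  with i Cons show ?case
    by (auto simp: a intro!: group_ring_free_group)
qed (simp add: group_ring_zero)

text \<open>The axioms characterising the Fox derivatives have exactly one solution.\<close>

lemma fox_derivative_ex1: "\<exists>!D. is_fox_derivative n j D"
proof (rule ex_ex1I)
  let ?Z = "group_ring (F n)"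
  define d where "d = (\<lambda>w :: nat fgroup. fox_word j (rep_fgroup w))"
  have d: "d (abs_fgroup u) = fox_word j u" for u
  proof -
    have "equivclp cancel_step (rep_fgroup (abs_fgroup u)) u"
      by (simp add: Quotient3_fgroup rep_abs_rsp_left)
    then show ?thesis unfolding d_def by (rule fox_word_cancel)
  qed
  have d_add: "d (u + v) = d u + frag_of u * d v" for u v
  proof -
    obtain u' v' where "u = abs_fgroup u'" "v = abs_fgroup v'"
      by (metis Quotient3_abs_rep Quotient3_fgroup)
    then show ?thesis by (simp add: abs_fgroup_append[symmetric] d fox_word_append)
  qed
  have d_closed: "d w \<in> ?Z" if w: "w \<in> carrier (F n)" for w
  proof -
    obtain u where "w = abs_fgroup u" "u \<in> lists ({1..n} \<times> UNIV)"
      using w by (auto simp: free_group_def)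
    then show ?thesis using fox_word_closed d by metis
  qed
  define E where "E = frag_extend d"
  have E_prod: "E (a * b) = E a * of_int (augmentation b) + a * E b" for a b
  proof -
    have 1: "E (frag_of u * b) = E (frag_of u) * of_int (augmentation b) + frag_of u * E b" for u b
      using subset_UNIV
    proof (induction b rule: frag_induction)
      case zero
      show ?case by (simp add: E_def augmentation_def)
    next
      case (one v)
      show ?case by (simp add: E_def frag_of_add[symmetric] d_add del: mult_single)
    next
      case (diff a b)
      then show ?case
        by (simp add: E_def frag_extend_diff right_diff_distrib augmentation_diff)
    qed
    show ?thesis
      using subset_UNIV
    proof (induction a rule: frag_induction)
      case zero
      show ?case by (simp add: E_def)
    next
      case (one v)
      show ?case by (rule 1)
    next
      case (diff a b)
      then show ?case
        by (simp add: E_def frag_extend_diff left_diff_distrib)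
    qed
  qed
  have E_closed: "E a \<in> ?Z" if "a \<in> ?Z" for a
    using keys_frag_extend[of d a] d_closed that unfolding E_def group_ring_def by blast
  have E_add: "E (a + b) = E a + E b" for a b
    by (simp add: E_def frag_extend_add)
  have E_gen: "E (frag_of (gen i)) = (if i = j then 1 else 0)" for i
    using d[of "[(i, True)]"] by (simp add: E_def abs_fgroup_letter)
  show "\<exists>D. is_fox_derivative n j D"
    using E_closed E_prod E_gen E_add
    by (intro exI[of _ "restrict E ?Z"])
      (simp add: is_fox_derivative_def group_ring_free_group)
next
  let ?Z = "group_ring (F n)"
  fix D E assume D: "is_fox_derivative n j D" and E: "is_fox_derivative n j E"
  have one: "(1 :: nat fgroup \<Rightarrow>\<^sub>0 int) \<in> ?Z"
    by (simp add: group_ring_def)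
  have prod: "K (a * b) = K a * of_int (augmentation b) + a * K b"
    if "is_fox_derivative n j K" "a \<in> ?Z" "b \<in> ?Z" for K a b
    using that by (auto simp: is_fox_derivative_def)
  have K_one: "K 1 = 0" if "is_fox_derivative n j K" for K
    using prod[OF that one one] by (simp add: augmentation_def)
  have K_inv: "K (frag_of (- gen i)) = - (frag_of (- gen i) * K (frag_of (gen i)))"
    if "is_fox_derivative n j K" "i \<in> {1..n}" for K i
  proof -
    have "K (frag_of (- gen i) * frag_of (gen i)) = 0"
      using K_one[OF that(1)] by (simp add: mult_single)
    with prod[OF that(1), of "frag_of (- gen i)" "frag_of (gen i)"] that(2) show ?thesis
      by (simp add: group_ring_frag_of eq_neg_iff_add_eq_0 del: mult_single)
  qed
  have add: "K (frag_of (u + v)) = K (frag_of u) + frag_of u * K (frag_of v)"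
    if "is_fox_derivative n j K" "u \<in> carrier (F n)" "v \<in> carrier (F n)" for K u v
    using prod[OF that(1), of "frag_of u" "frag_of v"] that
    by (simp add: group_ring_frag_of mult_single)
  have word: "D (frag_of w) = E (frag_of w)" if "w \<in> carrier (F n)" for w
    using that
  proof (induction w rule: free_group_induct)
    case zero
    show ?case using K_one[OF D] K_one[OF E] by simp
  next
    case (gen i u)
    moreover have "D (frag_of (gen i)) = E (frag_of (gen i))"
      using D E gen by (simp add: is_fox_derivative_def)
    ultimately show ?case
      using add[OF D] add[OF E] by simp
  next
    case (inv i u)
    moreover have "D (frag_of (gen i)) = E (frag_of (gen i))"
      using D E inv by (simp add: is_fox_derivative_def)
    ultimately have "D (frag_of (- gen i)) = E (frag_of (- gen i))"
      using K_inv D E by metis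
    with inv show ?case
      using add[OF D] add[OF E] by simp
  qed
  have diff: "K (a - b) = K a - K b" if "is_fox_derivative n j K" "a \<in> ?Z" "b \<in> ?Z" for K a b
  proof -
    have "K ((a - b) + b) = K (a - b) + K b"
      using that group_ring_diff unfolding is_fox_derivative_def by blast
    then show ?thesis by simp
  qed
  have zero: "K 0 = 0" if "is_fox_derivative n j K" for K
    using diff[OF that group_ring_zero group_ring_zero] by simp
  have "a \<in> ?Z \<and> D a = E a" if "Poly_Mapping.keys a \<subseteq> carrier (F n)" for a
    using that
    by (induction a rule: frag_induction)
      (use D E in \<open>auto simp: zero[OF D] zero[OF E] diff[OF D] diff[OF E] word intro: group_ring_free_group\<close>)
  then have "D a = E a" if "a \<in> ?Z" for a
    using that by (simp add: group_ring_def)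
  with D E show "D = E"
    unfolding is_fox_derivative_def by (meson PiE_ext)
qed

lemma fox: "is_fox_derivative n j (fox n j)"
  unfolding fox_def by (rule theI'[OF fox_derivative_ex1])

text \<open>
  \<open>F n \<rightarrow> free_Abelian_group {1..n}\<close>, \<open>x\<^sub>i \<mapsto> t\<^sub>i\<close>; here \<open>frag_of i\<close> is \<open>t\<^sub>i\<close> in additive notation.
\<close>

definition abelianize :: "nat \<Rightarrow> nat fgroup \<Rightarrow> (nat \<Rightarrow>\<^sub>0 int)"
  where "abelianize n = free_lift {1..n} (free_Abelian_group {1..n}) frag_of"

type_synonym laurent_poly = "(nat \<Rightarrow>\<^sub>0 int) \<Rightarrow>\<^sub>0 int"

definition phi :: "nat \<Rightarrow> (nat fgroup \<Rightarrow>\<^sub>0 int) \<Rightarrow> laurent_poly"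
  where "phi n = frag_extend (\<lambda>w. frag_of (abelianize n w))"

text \<open>The ring \<open>R = \<int>[t\<^sub>1\<^sup>\<plusminus>\<^sup>1, \<dots>, t\<^sub>n\<^sup>\<plusminus>\<^sup>1]\<close> and its unit group of matrices.\<close>

definition laurent_ring :: "nat \<Rightarrow> laurent_poly set"
  where "laurent_ring n = group_ring (free_Abelian_group {1..n})"

definition GL :: "nat \<Rightarrow> laurent_poly mat monoid"
  where "GL n = units_of
    ((ring_mat TYPE(laurent_poly) n ())
      \<lparr>carrier := {A \<in> carrier_mat n n. elements_mat A \<subseteq> laurent_ring n}\<rparr>)"


section \<open>Automorphisms of the free group\<close>

text \<open>Automorphisms act on the right: in the product \<open>\<alpha> \<otimes> \<beta>\<close> the map \<open>\<alpha>\<close> is applied first.\<close>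

definition Aut_F :: "nat \<Rightarrow> (nat fgroup \<Rightarrow> nat fgroup) monoid"
  where "Aut_F n =
    \<lparr>carrier = auto (F n),
     mult = (\<lambda>\<alpha> \<beta>. compose (carrier (F n)) \<beta> \<alpha>),
     one = (\<lambda>x\<in>carrier (F n). x)\<rparr>"

definition IA :: "nat \<Rightarrow> (nat fgroup \<Rightarrow> nat fgroup) monoid"
  where "IA n = (Aut_F n)
    \<lparr>carrier := {\<alpha> \<in> carrier (Aut_F n).
       \<forall>w\<in>carrier (F n). \<alpha> w - w \<in> derived (F n) (carrier (F n))}\<rparr>"

definition Cb :: "nat \<Rightarrow> (nat fgroup \<Rightarrow> nat fgroup) monoid"
  where "Cb n = (Aut_F n)
    \<lparr>carrier := {\<alpha> \<in> carrier (Aut_F n).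
       \<forall>i\<in>{1..n}. \<exists>f\<in>carrier (F n). \<alpha> (gen i) = - f + gen i + f}\<rparr>"


section \<open>The braid group and the pure braid group\<close>

definition presented_group :: "'a set \<Rightarrow> 'a fgroup set \<Rightarrow> 'a fgroup set monoid"
  where "presented_group S rels =
    free_group S Mod \<Inter>{N. N \<lhd> free_group S \<and> rels \<subseteq> N}"

definition braid_relators :: "nat \<Rightarrow> nat fgroup set"
  where "braid_relators n =
    {(gen i + gen (i + 1) + gen i) - (gen (i + 1) + gen i + gen (i + 1)) | i.
        i \<in> {1..<n} \<and> i + 1 \<in> {1..<n}} \<union>
    {(gen i + gen j) - (gen j + gen i) | i j.
        i \<in> {1..<n} \<and> j \<in> {1..<n} \<and> (i + 2 \<le> j \<or> j + 2 \<le> i)}"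

definition braid_group :: "nat \<Rightarrow> nat fgroup set monoid"
  where "braid_group n = presented_group {1..<n} (braid_relators n)"

text \<open>
  The homomorphism from \<open>braid_group n\<close> to \<open>G\<close> with \<open>\<sigma>\<^sub>i \<mapsto> f i\<close> (whenever the \<open>f i\<close> satisfy the braid
  relations): all words in a coset have the same value.
\<close>

definition braid_lift :: "nat \<Rightarrow> ('b, 'c) monoid_scheme \<Rightarrow> (nat \<Rightarrow> 'b) \<Rightarrow> nat fgroup set \<Rightarrow> 'b"
  where "braid_lift n G f = (\<lambda>X. the_elem (free_lift {1..<n} G f ` X))"

definition braid_perm :: "nat \<Rightarrow> nat fgroup set \<Rightarrow> (nat \<Rightarrow> nat)"
  where "braid_perm n = braid_lift n (sym_group n) (\<lambda>i. transpose i (i + 1))"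

definition sigma :: "nat \<Rightarrow> nat \<Rightarrow> (nat fgroup \<Rightarrow> nat fgroup)"
  where "sigma n i = free_lift {1..n} (F n)
    (\<lambda>l. if l = i then gen i + gen (i + 1) - gen i
         else if l = i + 1 then gen i
         else gen l)"

definition artin :: "nat \<Rightarrow> nat fgroup set \<Rightarrow> (nat fgroup \<Rightarrow> nat fgroup)"
  where "artin n = braid_lift n (Aut_F n) (sigma n)"

definition pure_braid_group :: "nat \<Rightarrow> nat fgroup set monoid"
  where "pure_braid_group n = (braid_group n)
    \<lparr>carrier := kernel (braid_group n) (sym_group n) (braid_perm n)\<rparr>"


section \<open>The Gassner and Magnus representations\<close>

text \<open>Matrices are indexed from 0 and generators from 1, whence the shifts.\<close>

definition fox_matrix :: "nat \<Rightarrow> (nat fgroup \<Rightarrow> nat fgroup) \<Rightarrow> laurent_poly mat"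
  where "fox_matrix n \<alpha> =
    mat n n (\<lambda>(i, j). phi n (fox n (j + 1) (frag_of (\<alpha> (gen (i + 1))))))"

lemma fox_frag_of:
  assumes "j \<in> {1..n}"
  shows fox_gen: "i \<in> {1..n} \<Longrightarrow> fox n j (frag_of (gen i)) = (if i = j then 1 else 0)"
    and fox_add: "u \<in> carrier (F n) \<Longrightarrow> v \<in> carrier (F n) \<Longrightarrow>
      fox n j (frag_of (u + v)) = fox n j (frag_of u) + frag_of u * fox n j (frag_of v)"
    and fox_inv: "u \<in> carrier (F n) \<Longrightarrow>
      fox n j (frag_of (- u)) = - (frag_of (- u) * fox n j (frag_of u))"
proof -
  have prod: "fox n j (a * b) = fox n j a * of_int (augmentation b) + a * fox n j b"
    if "a \<in> group_ring (F n)" "b \<in> group_ring (F n)" for a b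
    using fox[of n j] that by (simp add: is_fox_derivative_def)
  show add: "fox n j (frag_of (u + v)) = fox n j (frag_of u) + frag_of u * fox n j (frag_of v)"
    if "u \<in> carrier (F n)" "v \<in> carrier (F n)" for u v
    using prod[of "frag_of u" "frag_of v"] that
    by (simp add: group_ring_frag_of frag_of_add[symmetric] del: mult_single)
  show "fox n j (frag_of (- u)) = - (frag_of (- u) * fox n j (frag_of u))"
    if "u \<in> carrier (F n)" for u
    using add[of "- u" u] add[of 0 0] that by (simp add: eq_neg_iff_add_eq_0)
  show "fox n j (frag_of (gen i)) = (if i = j then 1 else 0)" if "i \<in> {1..n}"
    using fox[of n j] that by (simp add: is_fox_derivative_def)
qed

lemma abelianize_hom:
  shows abelianize_gen: "i \<in> {1..n} \<Longrightarrow> abelianize n (gen i) = frag_of i"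
    and abelianize_add: "u \<in> carrier (F n) \<Longrightarrow> v \<in> carrier (F n) \<Longrightarrow>
      abelianize n (u + v) = abelianize n u + abelianize n v"
    and abelianize_uminus: "u \<in> carrier (F n) \<Longrightarrow> abelianize n (- u) = - abelianize n u"
proof -
  have f: "frag_of \<in> {1..n} \<rightarrow> carrier (free_Abelian_group {1..n})"
    by auto
  note lift = group.free_lift[OF group_free_Abelian_group f, folded abelianize_def]
  show "abelianize n (gen i) = frag_of i" if "i \<in> {1..n}"
    using lift(3) that by blast
  show add: "abelianize n (u + v) = abelianize n u + abelianize n v"
    if "u \<in> carrier (F n)" "v \<in> carrier (F n)" for u v
    using hom_mult[OF lift(1)] that by simp
  show "abelianize n (- u) = - abelianize n u" if "u \<in> carrier (F n)"
    using add[of "- u" u] add[of 0 0] that by (simp add: eq_neg_iff_add_eq_0)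
qed

text \<open>
  The rows of the matrix of McCool's generator \<open>\<epsilon>\<^sub>i\<^sub>j\<close>: row \<open>i\<close> is
  \<open>t\<^sub>j\<^sup>-\<^sup>1 (t\<^sub>i - 1) e\<^sub>j + t\<^sub>j\<^sup>-\<^sup>1 e\<^sub>i\<close> and the others are those of the identity.
\<close>

lemma fox_matrix_mccool:
  fixes t :: "nat \<Rightarrow> laurent_poly" and t_inv :: "nat \<Rightarrow> laurent_poly"
  defines "t \<equiv> \<lambda>i. frag_of (frag_of i)" and "t_inv \<equiv> \<lambda>i. frag_of (- frag_of i)"
  assumes "i \<in> {1..n}" "j \<in> {1..n}" "i \<noteq> j" "k \<in> {1..n}" "l \<in> {1..n}"
    and "\<alpha> (gen k) = (if k = i then - gen j + gen i + gen j else gen k)"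
  shows "fox_matrix n \<alpha> $$ (k - 1, l - 1) =
    (if k = i then (if l = j then t_inv j * (t i - 1) else if l = i then t_inv j else 0)
     else if l = k then 1 else 0)"
proof -
  have idx: "k - 1 < n" "l - 1 < n" "Suc (k - 1) = k" "Suc (l - 1) = l"
    using assms by auto
  have phi_one: "phi n 1 = 1"
  proof -
    have "abelianize n 0 = 0" using abelianize_add[of 0 n 0] by simp
    moreover have "phi n (frag_of 0) = frag_of (abelianize n 0)"
      unfolding phi_def by (rule frag_extend_of)
    ultimately show ?thesis by simp
  qed
  have phi_zero: "phi n 0 = 0"
    by (simp add: phi_def)
  have entry: "fox_matrix n \<alpha> $$ (k - 1, l - 1) = phi n (fox n l (frag_of (\<alpha> (gen k))))"
    using idx by (simp add: fox_matrix_def)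
  show ?thesis
  proof (cases "k = i")
    case False
    then show ?thesis
      unfolding entry using assms fox_gen[of l n k] by (simp add: phi_one phi_zero)
  next
    case True
    have "fox n l (frag_of (\<alpha> (gen k))) =
      (if l = j then frag_of (- gen j + gen i) - frag_of (- gen j)
       else if l = i then frag_of (- gen j) else 0)"
      using assms True by (auto simp: fox_frag_of[of l n])
    then show ?thesis
      unfolding entry using assms True
      by (simp add: phi_zero)
        (simp add: phi_def frag_extend_diff abelianize_hom mult_single right_diff_distrib)
  qed
qed

definition gassner :: "nat \<Rightarrow> nat fgroup set \<Rightarrow> laurent_poly mat"
  where "gassner n = (\<lambda>p\<in>carrier (pure_braid_group n). fox_matrix n (artin n p))"

definition magnus :: "nat \<Rightarrow> (nat fgroup \<Rightarrow> nat fgroup) \<Rightarrow> laurent_poly mat"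
  where "magnus n = (\<lambda>\<alpha>\<in>carrier (IA n). fox_matrix n \<alpha>)"

definition gassner_hat :: "nat \<Rightarrow> (nat fgroup \<Rightarrow> nat fgroup) \<Rightarrow> laurent_poly mat"
  where "gassner_hat n = restrict (magnus n) (carrier (Cb n))"

end

theory Submission
  imports Defs
begin

text \<open>
  On \<open>Cb n\<close> the map \<open>gassner_hat n\<close> sends \<open>\<alpha>\<close> to the matrix of abelianized Fox derivatives of the
  images of the generators, and the Gassner matrix of a braid is the same expression for the
  automorphism by which the braid acts. The two maps therefore agree wherever both are defined, and
  the content lies in showing that all the maps involved are homomorphisms between the right groups.

  \<^bold>\<open>The Magnus map is multiplicative.\<close> An IA automorphism does not change the image of a word in the
  free abelian group. Hence, after abelianization, both sides of the chain rule
  \<open>\<partial>(h w)/\<partial>x\<^sub>j = \<Sum>\<^sub>k \<partial>w/\<partial>x\<^sub>k \<cdot> \<partial>(h x\<^sub>k)/\<partial>x\<^sub>j\<close> are derivations in \<open>w\<close> for the same action of the free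
  group, and they agree on generators (\<open>abelian_fox_chain_rule\<close>). Read as an identity of matrices,
  the chain rule says that the Magnus map is multiplicative; since automorphisms act on the right,
  the order of the factors is preserved. As the inverse of an IA automorphism is again IA, its matrix
  is a two-sided inverse over the Laurent ring. Basis-conjugating automorphisms are IA, because
  \<open>f\<^sup>-\<^sup>1 x\<^sub>i f x\<^sub>i\<^sup>-\<^sup>1\<close> is a commutator (\<open>Cb_subset_IA\<close>).

  \<^bold>\<open>Pure braids act by basis-conjugating automorphisms.\<close> Consider the pairs \<open>(\<alpha>, \<pi>)\<close> for which \<open>\<alpha>\<close>
  sends each generator \<open>x\<^bsub>\<pi> l\<^esub>\<close> to a conjugate of \<open>x\<^sub>l\<close>. They form a subgroup of \<open>Aut_F n \<times> sym_group n\<close>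
  (\<open>subgroup_perm_conj\<close>), and the pairs whose second component is the identity are exactly the
  elements of \<open>Cb n\<close>. The pair of images of \<open>\<sigma>\<^sub>i\<close> lies in the subgroup, so the pair of images of any
  braid does (\<open>artin_perm_conj\<close>); for a pure braid the permutation is trivial.
\<close>

text \<open>
  The index sets are written \<open>{1..n}\<close> in all definitions; rewriting \<open>1\<close> to \<open>Suc 0\<close> would hide the terms
  \<open>F n\<close> from the lemmas about them.
\<close>

declare One_nat_def [simp del]

section \<open>Homomorphisms out of a free group\<close>

lemma group_homI:
  "group G \<Longrightarrow> group H \<Longrightarrow> h \<in> hom G H \<Longrightarrow> group_hom G H h"
  by (simp add: group_hom_def group_hom_axioms_def)

lemma diff_in_free_group [simp]:
  "u \<in> carrier (free_group S) \<Longrightarrow> v \<in> carrier (free_group S) \<Longrightarrow> u - v \<in> carrier (free_group S)"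
  using add_in_free_group[of u S "- v"] by simp

text \<open>
  Orients every difference as a sum with inverses, so that words in the non-commutative additive
  notation have a normal form in which adjacent inverse letters cancel.
\<close>

lemmas free_group_normalize = diff_conv_add_uminus minus_add add.assoc

lemma free_group_hom_simps:
  assumes "h \<in> hom (free_group S) (free_group T)"
  shows free_hom_closed: "w \<in> carrier (free_group S) \<Longrightarrow> h w \<in> carrier (free_group T)"
    and free_hom_add: "u \<in> carrier (free_group S) \<Longrightarrow> v \<in> carrier (free_group S) \<Longrightarrow>
      h (u + v) = h u + h v"
    and free_hom_zero: "h 0 = 0"
    and free_hom_uminus: "w \<in> carrier (free_group S) \<Longrightarrow> h (- w) = - h w"
proof -
  interpret group_hom "free_group S" "free_group T" h
    using assms by (simp add: group_hom_def group_hom_axioms_def group_free_group)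
  show "w \<in> carrier (free_group S) \<Longrightarrow> h w \<in> carrier (free_group T)"
    "h 0 = 0" "w \<in> carrier (free_group S) \<Longrightarrow> h (- w) = - h w"
    using hom_closed[of w] hom_one hom_inv[of w] by simp_all
  show "u \<in> carrier (free_group S) \<Longrightarrow> v \<in> carrier (free_group S) \<Longrightarrow> h (u + v) = h u + h v"
    using hom_mult[of u v] by simp
qed

lemma free_group_hom_eqI:
  assumes h: "h \<in> hom (free_group S) (free_group T)" and k: "k \<in> hom (free_group S) (free_group T)"
    and gens: "\<And>i. i \<in> S \<Longrightarrow> h (gen i) = k (gen i)" and w: "w \<in> carrier (free_group S)"
  shows "h w = k w"
  using w by (induction w rule: free_group_induct)
    (simp_all add: gens free_hom_zero[OF h] free_hom_zero[OF k] free_hom_add[OF h]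
      free_hom_add[OF k] free_hom_uminus[OF h] free_hom_uminus[OF k])

section \<open>Automorphisms of the free group\<close>

lemma mult_Aut_F [simp]: "\<alpha> \<otimes>\<^bsub>Aut_F n\<^esub> \<beta> = compose (carrier (F n)) \<beta> \<alpha>"
  and one_Aut_F [simp]: "\<one>\<^bsub>Aut_F n\<^esub> = (\<lambda>x\<in>carrier (F n). x)"
  and carrier_Aut_F: "carrier (Aut_F n) = auto (F n)"
  by (simp_all add: Aut_F_def)

lemma Aut_F_hom: "\<alpha> \<in> carrier (Aut_F n) \<Longrightarrow> \<alpha> \<in> hom (F n) (F n)"
  by (simp add: carrier_Aut_F auto_def)

lemma Aut_F_extensional: "\<alpha> \<in> carrier (Aut_F n) \<Longrightarrow> \<alpha> \<in> extensional (carrier (F n))"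
  by (simp add: carrier_Aut_F auto_def Bij_def)

lemmas Aut_F_simps =
  free_hom_closed[OF Aut_F_hom] free_hom_add[OF Aut_F_hom] free_hom_zero[OF Aut_F_hom]
  free_hom_uminus[OF Aut_F_hom]

lemma Aut_F_eqI:
  assumes "\<alpha> \<in> carrier (Aut_F n)" "\<beta> \<in> carrier (Aut_F n)"
    and "\<And>i. i \<in> {1..n} \<Longrightarrow> \<alpha> (gen i) = \<beta> (gen i)"
  shows "\<alpha> = \<beta>"
proof (rule extensionalityI[OF assms(1,2)[THEN Aut_F_extensional]])
  fix w assume "w \<in> carrier (F n)"
  then show "\<alpha> w = \<beta> w"
    using free_group_hom_eqI[OF assms(1,2)[THEN Aut_F_hom]] assms(3) by blast
qed

lemma group_Aut_F: "group (Aut_F n)"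
proof (rule groupI)
  interpret F: group "F n" by (rule group_free_group)
  show "\<alpha> \<otimes>\<^bsub>Aut_F n\<^esub> \<beta> \<in> carrier (Aut_F n)"
    if "\<alpha> \<in> carrier (Aut_F n)" "\<beta> \<in> carrier (Aut_F n)" for \<alpha> \<beta>
    using that by (auto simp: carrier_Aut_F auto_def intro: F.hom_compose compose_Bij)
  show "\<one>\<^bsub>Aut_F n\<^esub> \<in> carrier (Aut_F n)"
    using F.id_in_auto by (simp add: carrier_Aut_F)
  show "\<alpha> \<otimes>\<^bsub>Aut_F n\<^esub> \<beta> \<otimes>\<^bsub>Aut_F n\<^esub> \<gamma> = \<alpha> \<otimes>\<^bsub>Aut_F n\<^esub> (\<beta> \<otimes>\<^bsub>Aut_F n\<^esub> \<gamma>)"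
    if "\<alpha> \<in> carrier (Aut_F n)" "\<beta> \<in> carrier (Aut_F n)" "\<gamma> \<in> carrier (Aut_F n)" for \<alpha> \<beta> \<gamma>
    by (rule ext) (use Aut_F_simps(1)[OF that(1)] in \<open>simp add: compose_def\<close>)
  show "\<one>\<^bsub>Aut_F n\<^esub> \<otimes>\<^bsub>Aut_F n\<^esub> \<alpha> = \<alpha>" if "\<alpha> \<in> carrier (Aut_F n)" for \<alpha>
    by (rule ext) (use Aut_F_extensional[OF that] in \<open>simp add: compose_def extensional_def\<close>)
  show "\<exists>\<beta>\<in>carrier (Aut_F n). \<beta> \<otimes>\<^bsub>Aut_F n\<^esub> \<alpha> = \<one>\<^bsub>Aut_F n\<^esub>"
    if "\<alpha> \<in> carrier (Aut_F n)" for \<alpha>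
  proof
    have \<alpha>: "\<alpha> \<in> hom (F n) (F n)" "\<alpha> \<in> Bij (carrier (F n))"
      using that by (simp_all add: carrier_Aut_F auto_def)
    let ?\<beta> = "restrict (inv_into (carrier (F n)) \<alpha>) (carrier (F n))"
    show "?\<beta> \<in> carrier (Aut_F n)"
      using \<alpha> by (simp add: carrier_Aut_F auto_def F.restrict_inv_into_hom restrict_inv_into_Bij)
    show "?\<beta> \<otimes>\<^bsub>Aut_F n\<^esub> \<alpha> = \<one>\<^bsub>Aut_F n\<^esub>"
      by (rule ext)
        (use \<alpha>(2) in \<open>simp add: compose_def Bij_def bij_betw_def inv_into_into f_inv_into_f\<close>)
  qed
qed

text \<open>
  Spells out the group inverse as an inverse function, so that arguments can be moved across it.
\<close>

lemma inv_Aut_F_apply: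
  assumes "\<alpha> \<in> carrier (Aut_F n)" "w \<in> carrier (F n)"
  shows inv_Aut_F_right: "\<alpha> ((inv\<^bsub>Aut_F n\<^esub> \<alpha>) w) = w"
    and inv_Aut_F_left: "(inv\<^bsub>Aut_F n\<^esub> \<alpha>) (\<alpha> w) = w"
proof -
  interpret group "Aut_F n" by (rule group_Aut_F)
  show "\<alpha> ((inv\<^bsub>Aut_F n\<^esub> \<alpha>) w) = w"
    using fun_cong[OF l_inv[OF assms(1)], of w] assms(2) by (simp add: compose_def)
  show "(inv\<^bsub>Aut_F n\<^esub> \<alpha>) (\<alpha> w) = w"
    using fun_cong[OF r_inv[OF assms(1)], of w] assms(2) by (simp add: compose_def)
qed

section \<open>The groups of IA and of basis-conjugating automorphisms\<close>

lemma IA_iff: "\<alpha> \<in> carrier (IA n) \<longleftrightarrow> \<alpha> \<in> carrier (Aut_F n) \<and>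
    (\<forall>w\<in>carrier (F n). \<alpha> w - w \<in> derived (F n) (carrier (F n)))"
  by (simp add: IA_def)

lemma Cb_iff: "\<alpha> \<in> carrier (Cb n) \<longleftrightarrow> \<alpha> \<in> carrier (Aut_F n) \<and>
    (\<forall>i\<in>{1..n}. \<exists>f\<in>carrier (F n). \<alpha> (gen i) = - f + gen i + f)"
  by (simp add: Cb_def)

text \<open>
  Normality of the derived subgroup and its commutators, in the additive notation in which \<open>IA n\<close> is
  defined.
\<close>

lemma derived_free_group:
  fixes S
  defines "D \<equiv> derived (free_group S) (carrier (free_group S))"
  shows derived_free_group_carrier: "x \<in> D \<Longrightarrow> x \<in> carrier (free_group S)"
    and derived_free_group_zero: "0 \<in> D"
    and derived_free_group_add: "x \<in> D \<Longrightarrow> y \<in> D \<Longrightarrow> x + y \<in> D"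
    and derived_free_group_uminus: "x \<in> D \<Longrightarrow> - x \<in> D"
    and derived_free_group_conj: "x \<in> D \<Longrightarrow> u \<in> carrier (free_group S) \<Longrightarrow> u + x - u \<in> D"
    and derived_free_group_commutator: "u \<in> carrier (free_group S) \<Longrightarrow>
      v \<in> carrier (free_group S) \<Longrightarrow> u + v - u - v \<in> D"
proof -
  interpret F: group "free_group S" by (rule group_free_group)
  interpret D: normal D "free_group S"
    unfolding D_def by (rule F.derived_self_is_normal)
  show c: "x \<in> D \<Longrightarrow> x \<in> carrier (free_group S)" for x by (rule D.mem_carrier)
  show "0 \<in> D" using D.one_closed by simp
  show "x \<in> D \<Longrightarrow> y \<in> D \<Longrightarrow> x + y \<in> D" using D.m_closed[of x y] by simp
  show "x \<in> D \<Longrightarrow> - x \<in> D" using D.m_inv_closed[of x] c[of x] by simp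
  show "x \<in> D \<Longrightarrow> u \<in> carrier (free_group S) \<Longrightarrow> u + x - u \<in> D"
    using D.inv_op_closed2[of u x] by simp
  show "u + v - u - v \<in> D" if "u \<in> carrier (free_group S)" "v \<in> carrier (free_group S)"
  proof -
    have "u + v - u - v = u \<otimes>\<^bsub>free_group S\<^esub> v \<otimes>\<^bsub>free_group S\<^esub> inv\<^bsub>free_group S\<^esub> u \<otimes>\<^bsub>free_group S\<^esub> inv\<^bsub>free_group S\<^esub> v"
      using that by simp
    with that show ?thesis
      unfolding D_def derived_def by (intro generate.incl) blast
  qed
qed

text \<open>
  For inverses, apply the hypothesis to \<open>u = \<alpha>\<^sup>-\<^sup>1 w\<close>: the quotient of \<open>u\<close> by \<open>w = \<alpha> u\<close> is the inverse of the quotient of \<open>\<alpha> u\<close>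
  by \<open>u\<close>. For products, insert \<open>\<alpha> w\<close> between \<open>\<beta> (\<alpha> w)\<close> and \<open>w\<close>.
\<close>

lemma subgroup_IA: "subgroup (carrier (IA n)) (Aut_F n)"
proof (rule group.subgroupI[OF group_Aut_F])
  interpret A: group "Aut_F n" by (rule group_Aut_F)
  show "carrier (IA n) \<subseteq> carrier (Aut_F n)" by (auto simp: IA_iff)
  have "\<one>\<^bsub>Aut_F n\<^esub> \<in> carrier (IA n)"
    using A.one_closed by (simp add: IA_iff derived_free_group_zero)
  then show "carrier (IA n) \<noteq> {}" by blast
  show "inv\<^bsub>Aut_F n\<^esub> \<alpha> \<in> carrier (IA n)" if \<alpha>: "\<alpha> \<in> carrier (IA n)" for \<alpha>
    unfolding IA_iff
  proof (intro conjI ballI)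
    show cl: "inv\<^bsub>Aut_F n\<^esub> \<alpha> \<in> carrier (Aut_F n)" using \<alpha> by (simp add: IA_iff)
    fix w assume w: "w \<in> carrier (F n)"
    let ?u = "(inv\<^bsub>Aut_F n\<^esub> \<alpha>) w"
    have "\<alpha> ?u - ?u \<in> derived (F n) (carrier (F n))"
      using \<alpha> Aut_F_simps(1)[OF cl w] by (simp add: IA_iff)
    from derived_free_group_uminus[OF this]
    show "?u - w \<in> derived (F n) (carrier (F n))"
      using \<alpha> w by (simp add: IA_iff inv_Aut_F_right)
  qed
  show "\<alpha> \<otimes>\<^bsub>Aut_F n\<^esub> \<beta> \<in> carrier (IA n)"
    if \<alpha>: "\<alpha> \<in> carrier (IA n)" and \<beta>: "\<beta> \<in> carrier (IA n)" for \<alpha> \<beta>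
    unfolding IA_iff
  proof (intro conjI ballI)
    show cl: "\<alpha> \<otimes>\<^bsub>Aut_F n\<^esub> \<beta> \<in> carrier (Aut_F n)"
      using \<alpha> \<beta> A.m_closed by (simp add: IA_iff)
    fix w assume w: "w \<in> carrier (F n)"
    have "(\<beta> (\<alpha> w) - \<alpha> w) + (\<alpha> w - w) \<in> derived (F n) (carrier (F n))"
      using \<alpha> \<beta> w Aut_F_simps(1)[of \<alpha> n w]
      by (intro derived_free_group_add) (simp_all add: IA_iff)
    then show "(\<alpha> \<otimes>\<^bsub>Aut_F n\<^esub> \<beta>) w - w \<in> derived (F n) (carrier (F n))"
      using w by (simp add: compose_def add_diff_eq)
  qed
qed

text \<open>
  Acting trivially modulo commutators is a condition on generators only, because
  \<open>\<alpha>(v u) (v u)\<^sup>-\<^sup>1 = (\<alpha> v v\<^sup>-\<^sup>1) \<cdot> v (\<alpha> u u\<^sup>-\<^sup>1) v\<^sup>-\<^sup>1\<close> and the derived subgroup is normal. On a generator,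
  \<open>f\<^sup>-\<^sup>1 x\<^sub>i f x\<^sub>i\<^sup>-\<^sup>1\<close> is a commutator.
\<close>

lemma Cb_subset_IA: "carrier (Cb n) \<subseteq> carrier (IA n)"
proof
  fix \<alpha> assume \<alpha>: "\<alpha> \<in> carrier (Cb n)"
  then have Aut: "\<alpha> \<in> carrier (Aut_F n)" by (simp add: Cb_iff)
  let ?D = "derived (F n) (carrier (F n))"
  note h = Aut_F_simps[OF Aut]
  have g: "\<alpha> (gen i) - gen i \<in> ?D" if "i \<in> {1..n}" for i
  proof -
    obtain f where f: "f \<in> carrier (F n)" "\<alpha> (gen i) = - f + gen i + f"
      using \<alpha> \<open>i \<in> {1..n}\<close> unfolding Cb_iff by blast
    then show ?thesis
      using derived_free_group_commutator[of "- f" "{1..n}" "gen i"] that by simp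
  qed
  have mult: "\<alpha> (v + u) - (v + u) \<in> ?D"
    if v: "v \<in> carrier (F n)" "\<alpha> v - v \<in> ?D" and u: "u \<in> carrier (F n)" "\<alpha> u - u \<in> ?D" for u v
  proof -
    have "(\<alpha> v - v) + (v + (\<alpha> u - u) - v) \<in> ?D"
      using u v by (intro derived_free_group_add derived_free_group_conj)
    also have "(\<alpha> v - v) + (v + (\<alpha> u - u) - v) = \<alpha> (v + u) - (v + u)"
      using u v by (simp add: h free_group_normalize
        del: add_uminus_conv_diff)
    finally show ?thesis .
  qed
  have g': "\<alpha> (- gen i) - (- gen i) \<in> ?D" if "i \<in> {1..n}" for i
  proof -
    have "- gen i + - (\<alpha> (gen i) - gen i) - (- gen i) \<in> ?D"
      using that by (intro derived_free_group_conj derived_free_group_uminus g) simp_all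
    then show ?thesis using that by (simp add: h minus_diff_eq free_group_normalize del: add_uminus_conv_diff)
  qed
  have "\<alpha> w - w \<in> ?D" if "w \<in> carrier (F n)" for w
    using that
  proof (induction w rule: free_group_induct)
    case zero show ?case by (simp add: h derived_free_group_zero)
  next
    case (gen i u) then show ?case by (intro mult g) simp_all
  next
    case (inv i u) then show ?case by (intro mult g') simp_all
  qed
  with Aut show "\<alpha> \<in> carrier (IA n)" by (simp add: IA_iff)
qed

section \<open>Automorphisms that permute the basis up to conjugation\<close>

text \<open>
  The permutation is applied to the index of the argument, not of the value. With \<open>\<alpha>\<close> applied first in
  \<open>\<alpha> \<otimes> \<beta>\<close> but \<open>\<rho>\<close> applied first in \<open>\<pi> \<circ> \<rho>\<close>, this is the choice for which the pairs multiply
  componentwise without reversing one of the factors.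
\<close>

definition perm_conj :: "nat \<Rightarrow> ((nat fgroup \<Rightarrow> nat fgroup) \<times> (nat \<Rightarrow> nat)) set"
  where "perm_conj n = {(\<alpha>, \<pi>). \<alpha> \<in> carrier (Aut_F n) \<and> \<pi> permutes {1..n} \<and>
    (\<forall>l\<in>{1..n}. \<exists>f\<in>carrier (F n). \<alpha> (gen (\<pi> l)) = - f + gen l + f)}"

lemma Cb_iff_perm_conj: "\<alpha> \<in> carrier (Cb n) \<longleftrightarrow> (\<alpha>, id) \<in> perm_conj n"
  by (simp add: Cb_iff perm_conj_def permutes_id)

text \<open>
  If \<open>\<alpha>\<close> sends \<open>x\<^bsub>\<pi>(\<rho> l)\<^esub>\<close> to the conjugate of \<open>x\<^bsub>\<rho> l\<^esub>\<close> by \<open>f\<close> and \<open>\<beta>\<close> sends \<open>x\<^bsub>\<rho> l\<^esub>\<close> to the conjugate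
  of \<open>x\<^sub>l\<close> by \<open>g\<close>, then \<open>\<alpha>\<close> followed by \<open>\<beta>\<close> conjugates by \<open>g \<cdot> \<beta> f\<close>. Applying \<open>\<alpha>\<^sup>-\<^sup>1\<close> to the equation for
  \<open>\<alpha> x\<^bsub>\<pi> m\<^esub>\<close> and solving for \<open>\<alpha>\<^sup>-\<^sup>1 x\<^sub>m\<close> gives the closure under inverses, with conjugator
  \<open>(\<alpha>\<^sup>-\<^sup>1 f)\<^sup>-\<^sup>1\<close>.
\<close>

lemma subgroup_perm_conj: "subgroup (perm_conj n) (Aut_F n \<times>\<times> sym_group n)"
proof (rule group.subgroupI[OF DirProd_group[OF group_Aut_F sym_group_is_group]])
  interpret A: group "Aut_F n" by (rule group_Aut_F)
  show "perm_conj n \<subseteq> carrier (Aut_F n \<times>\<times> sym_group n)"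
    by (auto simp: perm_conj_def sym_group_carrier)
  have "(\<one>\<^bsub>Aut_F n\<^esub>, id) \<in> perm_conj n"
    using A.one_closed by (auto simp: perm_conj_def permutes_id intro: bexI[of _ 0])
  then show "perm_conj n \<noteq> {}" by blast
  fix a assume "a \<in> perm_conj n"
  then obtain \<alpha> \<pi> where a: "a = (\<alpha>, \<pi>)" "\<alpha> \<in> carrier (Aut_F n)" "\<pi> permutes {1..n}"
    and conj: "\<And>l. l \<in> {1..n} \<Longrightarrow> \<exists>f\<in>carrier (F n). \<alpha> (gen (\<pi> l)) = - f + gen l + f"
    by (auto simp: perm_conj_def)
  have "\<exists>f\<in>carrier (F n). (inv\<^bsub>Aut_F n\<^esub> \<alpha>) (gen (inv' \<pi> l)) = - f + gen l + f"
    if l: "l \<in> {1..n}" for l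
  proof -
    let ?m = "inv' \<pi> l" and ?\<beta> = "inv\<^bsub>Aut_F n\<^esub> \<alpha>"
    have m: "?m \<in> {1..n}" "\<pi> ?m = l"
      using permutes_in_image[OF permutes_inv[OF a(3)], of l] l permutes_inverses(1)[OF a(3)] by auto
    obtain f where f: "f \<in> carrier (F n)" "\<alpha> (gen l) = - f + gen ?m + f"
      using conj[OF m(1)] m(2) by auto
    note \<beta> = Aut_F_simps[OF A.inv_closed[OF a(2)]]
    have "gen l = - ?\<beta> f + ?\<beta> (gen ?m) + ?\<beta> f"
      using inv_Aut_F_left[OF a(2), of "gen l"] l m f by (simp add: \<beta>)
    then have "?\<beta> (gen ?m) = - (- ?\<beta> f) + gen l + - ?\<beta> f"
      by (simp add: free_group_normalize
        del: add_uminus_conv_diff)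
    then show ?thesis using f by (intro bexI[of _ "- ?\<beta> f"]) (auto simp: \<beta>)
  qed
  then show "inv\<^bsub>Aut_F n \<times>\<times> sym_group n\<^esub> a \<in> perm_conj n"
    using a A.inv_closed permutes_inv
    by (simp add: perm_conj_def inv_DirProd[OF group_Aut_F sym_group_is_group] sym_group_carrier)
  fix b assume "b \<in> perm_conj n"
  then obtain \<beta> \<rho> where b: "b = (\<beta>, \<rho>)" "\<beta> \<in> carrier (Aut_F n)" "\<rho> permutes {1..n}"
    and conj': "\<And>l. l \<in> {1..n} \<Longrightarrow> \<exists>f\<in>carrier (F n). \<beta> (gen (\<rho> l)) = - f + gen l + f"
    by (auto simp: perm_conj_def)
  have "\<exists>f\<in>carrier (F n). (\<alpha> \<otimes>\<^bsub>Aut_F n\<^esub> \<beta>) (gen ((\<pi> \<circ> \<rho>) l)) = - f + gen l + f"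
    if l: "l \<in> {1..n}" for l
  proof -
    have \<rho>l: "\<rho> l \<in> {1..n}" "\<pi> (\<rho> l) \<in> {1..n}"
      using permutes_in_image[OF b(3)] permutes_in_image[OF a(3)] l by auto
    obtain f where f: "f \<in> carrier (F n)" "\<alpha> (gen (\<pi> (\<rho> l))) = - f + gen (\<rho> l) + f"
      using conj[OF \<rho>l(1)] by blast
    obtain g where g: "g \<in> carrier (F n)" "\<beta> (gen (\<rho> l)) = - g + gen l + g"
      using conj'[OF l] by blast
    have "(\<alpha> \<otimes>\<^bsub>Aut_F n\<^esub> \<beta>) (gen ((\<pi> \<circ> \<rho>) l)) = - (g + \<beta> f) + gen l + (g + \<beta> f)"
      using f g \<rho>l by (simp add: compose_def Aut_F_simps[OF b(2)] free_group_normalize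
        del: add_uminus_conv_diff)
    then show ?thesis using f g by (intro bexI[of _ "g + \<beta> f"]) (auto simp: Aut_F_simps[OF b(2)])
  qed
  then show "a \<otimes>\<^bsub>Aut_F n \<times>\<times> sym_group n\<^esub> b \<in> perm_conj n"
    using a b A.m_closed permutes_compose[OF b(3) a(3)] by (simp add: perm_conj_def sym_group_mult)
qed

text \<open>
  \<open>Cb n\<close> is the fibre of the previous subgroup over the trivial permutation.
\<close>

lemma subgroup_Cb: "subgroup (carrier (Cb n)) (Aut_F n)"
proof (rule group.subgroupI[OF group_Aut_F])
  interpret K: subgroup "perm_conj n" "Aut_F n \<times>\<times> sym_group n" by (rule subgroup_perm_conj)
  show "carrier (Cb n) \<subseteq> carrier (Aut_F n)" by (auto simp: Cb_iff)
  show "carrier (Cb n) \<noteq> {}"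
    using K.one_closed Cb_iff_perm_conj[of "\<one>\<^bsub>Aut_F n\<^esub>" n] by (auto simp: sym_group_one)
  show "inv\<^bsub>Aut_F n\<^esub> \<alpha> \<in> carrier (Cb n)" if "\<alpha> \<in> carrier (Cb n)" for \<alpha>
  proof -
    have "\<alpha> \<in> carrier (Aut_F n)" "id \<in> carrier (sym_group n)"
      using that by (simp_all add: Cb_iff sym_group_carrier permutes_id)
    with K.m_inv_closed[of "(\<alpha>, id)"] that show ?thesis
      by (simp add: Cb_iff_perm_conj inv_DirProd[OF group_Aut_F sym_group_is_group])
  qed
  show "\<alpha> \<otimes>\<^bsub>Aut_F n\<^esub> \<beta> \<in> carrier (Cb n)"
    if "\<alpha> \<in> carrier (Cb n)" "\<beta> \<in> carrier (Cb n)" for \<alpha> \<beta>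
    using K.m_closed[of "(\<alpha>, id)" "(\<beta>, id)"] that by (simp add: Cb_iff_perm_conj sym_group_mult)
qed

section \<open>The Magnus representation\<close>

definition abelian_fox :: "nat \<Rightarrow> nat \<Rightarrow> nat fgroup \<Rightarrow> laurent_poly"
  where "abelian_fox n j w = phi n (fox n j (frag_of w))"

lemma fox_closed: "w \<in> carrier (F n) \<Longrightarrow> fox n j (frag_of w) \<in> group_ring (F n)"
  using fox[of n j] by (auto simp: is_fox_derivative_def group_ring_frag_of)

text \<open>
  A left factor that is a group element is the only kind of product that the rules for the Fox
  derivative of a word produce.
\<close>

lemma phi_frag_mult:
  assumes "u \<in> carrier (F n)" "a \<in> group_ring (F n)"
  shows "phi n (frag_of u * a) = frag_of (abelianize n u) * phi n a"
proof -
  have "Poly_Mapping.keys a \<subseteq> carrier (F n)" using assms(2) by (simp add: group_ring_def)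
  then show ?thesis
  proof (induction a rule: frag_induction)
    case (one v)
    then show ?case
      using assms(1) by (simp add: mult_single phi_def abelianize_add)
  next
    case (diff a b)
    then show ?case by (simp add: right_diff_distrib phi_def frag_extend_diff)
  qed (simp add: phi_def)
qed

text \<open>
  The abelianized Fox derivative is a derivation of the free group with values in the Laurent ring, on
  which a word acts by multiplication with its abelianization. These rules determine it.
\<close>

lemma abelian_fox_simps:
  assumes "j \<in> {1..n}"
  shows abelian_fox_gen: "i \<in> {1..n} \<Longrightarrow> abelian_fox n j (gen i) = (if i = j then 1 else 0)"
    and abelian_fox_add: "u \<in> carrier (F n) \<Longrightarrow> v \<in> carrier (F n) \<Longrightarrow>
      abelian_fox n j (u + v) = abelian_fox n j u + frag_of (abelianize n u) * abelian_fox n j v"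
    and abelian_fox_zero: "abelian_fox n j 0 = 0"
    and abelian_fox_uminus: "u \<in> carrier (F n) \<Longrightarrow>
      abelian_fox n j (- u) = - frag_of (- abelianize n u) * abelian_fox n j u"
proof -
  have ab0: "abelianize n 0 = 0" using abelianize_add[of 0 n 0] by simp
  have phi_one: "phi n 1 = 1"
    using frag_extend_of[of "\<lambda>w. frag_of (abelianize n w)" 0] by (simp add: phi_def ab0)
  show "i \<in> {1..n} \<Longrightarrow> abelian_fox n j (gen i) = (if i = j then 1 else 0)"
    using fox_gen[OF assms, of i] phi_one by (simp add: abelian_fox_def phi_def)
  show "abelian_fox n j (u + v) = abelian_fox n j u + frag_of (abelianize n u) * abelian_fox n j v"
    if "u \<in> carrier (F n)" "v \<in> carrier (F n)" for u v
    using that phi_frag_mult[OF that(1) fox_closed[OF that(2)]]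
    by (simp add: abelian_fox_def fox_add[OF assms] phi_def frag_extend_add)
  from this[of 0 0] show "abelian_fox n j 0 = 0" by (simp add: ab0)
  show "abelian_fox n j (- u) = - frag_of (- abelianize n u) * abelian_fox n j u"
    if u: "u \<in> carrier (F n)" for u
    using phi_frag_mult[OF uminus_in_free_group[OF u] fox_closed[OF u]]
    by (simp add: abelian_fox_def fox_inv[OF assms u] abelianize_uminus[OF u])
      (simp add: phi_def frag_extend_minus)
qed

lemma abelianize_closed: "w \<in> carrier (F n) \<Longrightarrow> Poly_Mapping.keys (abelianize n w) \<subseteq> {1..n}"
proof -
  have "frag_of \<in> {1..n} \<rightarrow> carrier (free_Abelian_group {1..n})" by auto
  from hom_carrier[OF group.free_lift_hom[OF group_free_Abelian_group this, folded abelianize_def]]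
  show "Poly_Mapping.keys (abelianize n w) \<subseteq> {1..n}" if "w \<in> carrier (F n)"
    using that by (metis carrier_free_Abelian_group_iff image_subset_iff)
qed

lemma abelian_fox_closed:
  assumes "w \<in> carrier (F n)" shows "abelian_fox n j w \<in> laurent_ring n"
proof -
  have "Poly_Mapping.keys (abelian_fox n j w) \<subseteq>
      (\<Union>v\<in>Poly_Mapping.keys (fox n j (frag_of w)). {abelianize n v})"
    using keys_frag_extend[of "\<lambda>w. frag_of (abelianize n w)"] by (simp add: abelian_fox_def phi_def)
  also have "\<dots> \<subseteq> carrier (free_Abelian_group {1..n})"
    using fox_closed[OF assms, of j] abelianize_closed by (fastforce simp: group_ring_def)
  finally show ?thesis by (simp add: laurent_ring_def group_ring_def)
qed

lemma IA_Aut_F: "\<alpha> \<in> carrier (IA n) \<Longrightarrow> \<alpha> \<in> carrier (Aut_F n)"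
  by (simp add: IA_iff)

text \<open>
  The free abelian group is commutative, so abelianization kills the derived subgroup.
\<close>

lemma IA_abelianize:
  assumes \<alpha>: "\<alpha> \<in> carrier (IA n)" and w: "w \<in> carrier (F n)"
  shows "abelianize n (\<alpha> w) = abelianize n w"
proof -
  interpret F: group "F n" by (rule group_free_group)
  interpret ab: group_hom "F n" "free_Abelian_group {1..n}" "abelianize n"
    unfolding abelianize_def
    by (intro group_hom.intro group_hom_axioms.intro group_free_group group_free_Abelian_group
        group.free_lift_hom) auto
  have "derived (F n) (carrier (F n)) \<subseteq> kernel (F n) (free_Abelian_group {1..n}) (abelianize n)"
    unfolding derived_def
    by (intro F.generate_subgroup_incl ab.subgroup_kernel)
      (auto simp: kernel_def abelianize_add abelianize_uminus diff_conv_add_uminus simp del: add_uminus_conv_diff)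
  moreover have "\<alpha> w - w \<in> derived (F n) (carrier (F n))"
    using assms by (simp add: IA_iff)
  ultimately have "abelianize n (\<alpha> w + - w) = 0"
    by (auto simp: kernel_def)
  moreover have "\<alpha> w \<in> carrier (F n)"
    using \<alpha> w Aut_F_simps(1)[of \<alpha> n w] by (simp add: IA_iff)
  ultimately show ?thesis
    using w abelianize_add[of "\<alpha> w" n "- w"] by (simp add: abelianize_uminus)
qed

text \<open>
  Both sides are derivations in \<open>w\<close>: the right-hand side is a combination of the derivations
  \<open>\<partial>w/\<partial>x\<^sub>k\<close> with constants on the right, and on the left-hand side the factor \<open>\<phi>(h u)\<close> of the product
  rule equals \<open>\<phi>(u)\<close> by the hypothesis on \<open>h\<close>. On a generator \<open>x\<^sub>i\<close> only the summand for \<open>x\<^sub>i\<close> survives.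
\<close>

lemma abelian_fox_chain_rule:
  assumes h: "h \<in> hom (F n) (F n)"
    and ab: "\<And>w. w \<in> carrier (F n) \<Longrightarrow> abelianize n (h w) = abelianize n w"
    and j: "j \<in> {1..n}" and w: "w \<in> carrier (F n)"
  shows "abelian_fox n j (h w) =
    (\<Sum>k = 0..<n. abelian_fox n (k + 1) w * abelian_fox n j (h (gen (k + 1))))"
proof -
  let ?P = "\<lambda>w. abelian_fox n j (h w) =
    (\<Sum>k = 0..<n. abelian_fox n (k + 1) w * abelian_fox n j (h (gen (k + 1))))"
  note h = free_group_hom_simps[OF h]
  have k: "k + 1 \<in> {1..n}" if "k \<in> {0..<n}" for k using that by simp
  have P_gen: "?P (gen i)" if i: "i \<in> {1..n}" for i
  proof -
    have "(\<Sum>k = 0..<n. abelian_fox n (k + 1) (gen i) * abelian_fox n j (h (gen (k + 1))))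
      = (\<Sum>k = 0..<n. if k = i - 1 then abelian_fox n j (h (gen i)) else 0)"
      using i by (intro sum.cong) (auto simp: abelian_fox_gen[OF k])
    also have "\<dots> = abelian_fox n j (h (gen i))" using i by auto
    finally show ?thesis ..
  qed
  have P_add: "?P (u + v)" if u: "u \<in> carrier (F n)" "?P u" and v: "v \<in> carrier (F n)" "?P v" for u v
  proof -
    have "abelian_fox n j (h (u + v)) =
      abelian_fox n j (h u) + frag_of (abelianize n u) * abelian_fox n j (h v)"
      using u(1) v(1) by (simp add: h abelian_fox_add[OF j] ab)
    also have "\<dots> = (\<Sum>k = 0..<n. (abelian_fox n (k + 1) u
        + frag_of (abelianize n u) * abelian_fox n (k + 1) v) * abelian_fox n j (h (gen (k + 1))))"
      unfolding u(2) v(2) by (simp add: sum_distrib_left sum.distrib distrib_right mult.assoc)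
    also have "\<dots> = (\<Sum>k = 0..<n. abelian_fox n (k + 1) (u + v) * abelian_fox n j (h (gen (k + 1))))"
      by (intro sum.cong refl) (simp only: abelian_fox_add[OF k u(1) v(1)])
    finally show ?thesis .
  qed
  have P_uminus: "?P (- u)" if u: "u \<in> carrier (F n)" "?P u" for u
  proof -
    have "abelian_fox n j (h (- u)) = - frag_of (- abelianize n u) * abelian_fox n j (h u)"
      using u(1) by (simp add: h abelian_fox_uminus[OF j] ab)
    also have "\<dots> = (\<Sum>k = 0..<n. - frag_of (- abelianize n u) * abelian_fox n (k + 1) u
        * abelian_fox n j (h (gen (k + 1))))"
      unfolding u(2) by (simp only: sum_distrib_left mult.assoc)
    also have "\<dots> = (\<Sum>k = 0..<n. abelian_fox n (k + 1) (- u) * abelian_fox n j (h (gen (k + 1))))"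
      by (intro sum.cong refl) (simp only: abelian_fox_uminus[OF k u(1)])
    finally show ?thesis .
  qed
  have P_zero: "?P 0"
    unfolding h(3) abelian_fox_zero[OF j]
    by (rule sum.neutral[symmetric]) (simp add: abelian_fox_zero)
  show ?thesis
    using w
  proof (induction w rule: free_group_induct)
    case zero show ?case by (rule P_zero)
  next
    case (gen i u) then show ?case by (intro P_add P_gen) simp_all
  next
    case (inv i u) then show ?case by (intro P_add P_uminus P_gen) simp_all
  qed
qed

lemma fox_matrix_eq:
  "fox_matrix n \<alpha> = mat n n (\<lambda>(i, j). abelian_fox n (j + 1) (\<alpha> (gen (i + 1))))"
  by (simp add: fox_matrix_def abelian_fox_def)

lemma fox_matrix_mult:
  assumes \<alpha>: "\<alpha> \<in> carrier (IA n)" and \<beta>: "\<beta> \<in> carrier (IA n)"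
  shows "fox_matrix n (\<alpha> \<otimes>\<^bsub>Aut_F n\<^esub> \<beta>) = fox_matrix n \<alpha> * fox_matrix n \<beta>"
proof (rule eq_matI)
  fix i j assume "i < dim_row (fox_matrix n \<alpha> * fox_matrix n \<beta>)"
    and "j < dim_col (fox_matrix n \<alpha> * fox_matrix n \<beta>)"
  then have ij: "i < n" "j < n" by (simp_all add: fox_matrix_def)
  have \<alpha>i: "\<alpha> (gen (i + 1)) \<in> carrier (F n)"
    using Aut_F_simps(1)[OF IA_Aut_F[OF \<alpha>]] ij by simp
  have "abelian_fox n (j + 1) (\<beta> (\<alpha> (gen (i + 1)))) = (\<Sum>k = 0..<n.
      abelian_fox n (k + 1) (\<alpha> (gen (i + 1))) * abelian_fox n (j + 1) (\<beta> (gen (k + 1))))"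
    using ij by (intro abelian_fox_chain_rule[OF Aut_F_hom[OF IA_Aut_F[OF \<beta>]] IA_abelianize[OF \<beta>] _ \<alpha>i]) simp_all
  then show "fox_matrix n (\<alpha> \<otimes>\<^bsub>Aut_F n\<^esub> \<beta>) $$ (i, j) = (fox_matrix n \<alpha> * fox_matrix n \<beta>) $$ (i, j)"
    using ij by (simp add: fox_matrix_eq scalar_prod_def compose_def)
qed (simp_all add: fox_matrix_def)

lemma fox_matrix_one: "fox_matrix n \<one>\<^bsub>Aut_F n\<^esub> = 1\<^sub>m n"
  by (rule eq_matI) (auto simp: fox_matrix_eq abelian_fox_gen)

lemma laurent_ring_closed:
  shows laurent_ring_zero: "0 \<in> laurent_ring n"
    and laurent_ring_one: "1 \<in> laurent_ring n"
    and laurent_ring_add: "a \<in> laurent_ring n \<Longrightarrow> b \<in> laurent_ring n \<Longrightarrow> a + b \<in> laurent_ring n"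
    and laurent_ring_mult: "a \<in> laurent_ring n \<Longrightarrow> b \<in> laurent_ring n \<Longrightarrow> a * b \<in> laurent_ring n"
proof -
  show "0 \<in> laurent_ring n" "1 \<in> laurent_ring n"
    by (simp_all add: laurent_ring_def group_ring_def)
  show "a + b \<in> laurent_ring n" if "a \<in> laurent_ring n" "b \<in> laurent_ring n"
    using that Poly_Mapping.keys_add[of a b] by (auto simp: laurent_ring_def group_ring_def)
  show "a * b \<in> laurent_ring n" if ab: "a \<in> laurent_ring n" "b \<in> laurent_ring n"
  proof -
    have keys: "Poly_Mapping.keys g \<subseteq> {1..n}"
      if "g \<in> Poly_Mapping.keys a \<or> g \<in> Poly_Mapping.keys b" for g
      using ab that by (auto simp: laurent_ring_def group_ring_def subset_iff)
    have "g \<in> carrier (free_Abelian_group {1..n})" if g: "g \<in> Poly_Mapping.keys (a * b)" for g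
    proof -
      obtain u v where "g = u + v" "u \<in> Poly_Mapping.keys a" "v \<in> Poly_Mapping.keys b"
        using keys_mult[of a b] g by blast
      then show ?thesis
        using Poly_Mapping.keys_add[of u v] keys[of u] keys[of v]
        unfolding carrier_free_Abelian_group_iff by blast
    qed
    then show ?thesis by (auto simp only: laurent_ring_def group_ring_def)
  qed
qed

abbreviation laurent_mat :: "nat \<Rightarrow> laurent_poly mat ring"
  where "laurent_mat n \<equiv> (ring_mat TYPE(laurent_poly) n ())
    \<lparr>carrier := {A \<in> carrier_mat n n. elements_mat A \<subseteq> laurent_ring n}\<rparr>"

lemma carrier_laurent_mat:
  "A \<in> carrier (laurent_mat n) \<longleftrightarrow>
    A \<in> carrier_mat n n \<and> (\<forall>i<n. \<forall>j<n. A $$ (i, j) \<in> laurent_ring n)"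
  by (fastforce dest: elements_matD)

lemma monoid_laurent_mat: "monoid (laurent_mat n)"
proof (rule monoidI)
  fix A B assume A: "A \<in> carrier (laurent_mat n)" and B: "B \<in> carrier (laurent_mat n)"
  have "(\<Sum>k = 0..<n. A $$ (i, k) * B $$ (k, j)) \<in> laurent_ring n" if "i < n" "j < n" for i j
  proof -
    have *: "(\<Sum>k\<in>K. A $$ (i, k) * B $$ (k, j)) \<in> laurent_ring n" if "K \<subseteq> {0..<n}" for K
      using finite_subset[OF that finite_atLeastLessThan] that
    proof (induction K rule: finite_induct)
      case (insert k K)
      then show ?case
        using A B \<open>i < n\<close> \<open>j < n\<close> unfolding carrier_laurent_mat
        by (auto intro!: laurent_ring_add laurent_ring_mult)
    qed (simp add: laurent_ring_zero)
    show ?thesis by (rule *) simp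
  qed
  with A B show "A \<otimes>\<^bsub>laurent_mat n\<^esub> B \<in> carrier (laurent_mat n)"
    unfolding carrier_laurent_mat by (auto simp: ring_mat_simps scalar_prod_def)
next
  show "\<one>\<^bsub>laurent_mat n\<^esub> \<in> carrier (laurent_mat n)"
    unfolding carrier_laurent_mat by (simp add: ring_mat_simps laurent_ring_zero laurent_ring_one)
qed (auto simp: ring_mat_simps assoc_mult_mat[of _ n n _ n _ n])

lemma group_GL: "group (GL n)"
  unfolding GL_def by (rule monoid.units_group[OF monoid_laurent_mat])

lemma fox_matrix_closed:
  assumes "\<alpha> \<in> carrier (IA n)" shows "fox_matrix n \<alpha> \<in> carrier (laurent_mat n)"
  unfolding carrier_laurent_mat
proof (intro conjI allI impI)
  fix i j assume "i < n" "j < n"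
  moreover have "\<alpha> (gen (i + 1)) \<in> carrier (F n)"
    using Aut_F_simps(1)[OF IA_Aut_F[OF assms]] \<open>i < n\<close> by simp
  ultimately show "fox_matrix n \<alpha> $$ (i, j) \<in> laurent_ring n"
    using abelian_fox_closed[of "\<alpha> (gen (i + 1))" n "j + 1"] by (simp add: fox_matrix_eq)
qed (simp add: fox_matrix_def)

lemma group_IA: "group (IA n)"
proof -
  have IA: "(Aut_F n)\<lparr>carrier := carrier (IA n)\<rparr> = IA n" by (simp add: IA_def)
  show ?thesis using subgroup.subgroup_is_group[OF subgroup_IA[of n] group_Aut_F] unfolding IA .
qed

lemma group_Cb: "group (Cb n)"
proof -
  have Cb: "(Aut_F n)\<lparr>carrier := carrier (Cb n)\<rparr> = Cb n" by (simp add: Cb_def)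
  show ?thesis using subgroup.subgroup_is_group[OF subgroup_Cb[of n] group_Aut_F] unfolding Cb .
qed

lemma mult_IA: "mult (IA n) = mult (Aut_F n)" and mult_Cb: "mult (Cb n) = mult (Aut_F n)"
  by (simp_all add: IA_def Cb_def)

text \<open>
  The matrix of the inverse automorphism shows that each value is invertible over the Laurent ring, and
  not merely over its field of fractions.
\<close>

lemma magnus_group_hom: "group_hom (IA n) (GL n) (magnus n)"
proof (rule group_homI[OF group_IA group_GL homI])
  interpret A: group "Aut_F n" by (rule group_Aut_F)
  interpret IA: subgroup "carrier (IA n)" "Aut_F n" by (rule subgroup_IA)
  fix \<alpha> assume \<alpha>: "\<alpha> \<in> carrier (IA n)"
  have inv: "inv\<^bsub>Aut_F n\<^esub> \<alpha> \<in> carrier (IA n)" using \<alpha> by (rule IA.m_inv_closed)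
  have "fox_matrix n \<alpha> * fox_matrix n (inv\<^bsub>Aut_F n\<^esub> \<alpha>) = 1\<^sub>m n"
    "fox_matrix n (inv\<^bsub>Aut_F n\<^esub> \<alpha>) * fox_matrix n \<alpha> = 1\<^sub>m n"
    using \<alpha> inv fox_matrix_one by (simp_all only: fox_matrix_mult[symmetric] A.r_inv A.l_inv IA.mem_carrier)
  then have "fox_matrix n \<alpha> \<in> Units (laurent_mat n)"
    using fox_matrix_closed[OF \<alpha>] fox_matrix_closed[OF inv]
    unfolding Units_def by (auto simp: ring_mat_simps)
  then show "magnus n \<alpha> \<in> carrier (GL n)"
    using \<alpha> by (simp add: magnus_def GL_def units_of_carrier)
  fix \<beta> assume \<beta>: "\<beta> \<in> carrier (IA n)"
  have "\<alpha> \<otimes>\<^bsub>Aut_F n\<^esub> \<beta> \<in> carrier (IA n)" using \<alpha> \<beta> by (rule IA.m_closed)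
  then show "magnus n (\<alpha> \<otimes>\<^bsub>IA n\<^esub> \<beta>) = magnus n \<alpha> \<otimes>\<^bsub>GL n\<^esub> magnus n \<beta>"
    using \<alpha> \<beta> fox_matrix_mult[OF \<alpha> \<beta>]
    by (simp add: magnus_def mult_IA GL_def units_of_mult ring_mat_simps del: mult_Aut_F)
qed

lemma gassner_hat_eq: "\<alpha> \<in> carrier (Cb n) \<Longrightarrow> gassner_hat n \<alpha> = fox_matrix n \<alpha>"
  using subsetD[OF Cb_subset_IA] by (simp add: gassner_hat_def magnus_def)

lemma gassner_hat_group_hom: "group_hom (Cb n) (GL n) (gassner_hat n)"
proof (rule group_homI[OF group_Cb group_GL homI])
  interpret M: group_hom "IA n" "GL n" "magnus n" by (rule magnus_group_hom)
  interpret Cb: subgroup "carrier (Cb n)" "Aut_F n" by (rule subgroup_Cb)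
  fix \<alpha> assume \<alpha>: "\<alpha> \<in> carrier (Cb n)"
  then show "gassner_hat n \<alpha> \<in> carrier (GL n)"
    using M.hom_closed[OF subsetD[OF Cb_subset_IA \<alpha>]] by (simp add: gassner_hat_def)
  fix \<beta> assume \<beta>: "\<beta> \<in> carrier (Cb n)"
  have "\<alpha> \<otimes>\<^bsub>Cb n\<^esub> \<beta> \<in> carrier (Cb n)"
    using Cb.m_closed[OF \<alpha> \<beta>] by (simp only: mult_Cb)
  then show "gassner_hat n (\<alpha> \<otimes>\<^bsub>Cb n\<^esub> \<beta>) = gassner_hat n \<alpha> \<otimes>\<^bsub>GL n\<^esub> gassner_hat n \<beta>"
    using \<alpha> \<beta> M.hom_mult[OF \<alpha>[THEN subsetD[OF Cb_subset_IA]] \<beta>[THEN subsetD[OF Cb_subset_IA]]]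
    by (simp add: gassner_hat_def mult_IA mult_Cb del: mult_Aut_F)
qed

section \<open>Homomorphisms out of the braid group\<close>

definition relator_closure :: "'a set \<Rightarrow> 'a fgroup set \<Rightarrow> 'a fgroup set"
  where "relator_closure S rels = \<Inter>{N. N \<lhd> free_group S \<and> rels \<subseteq> N}"

lemma relator_closure_normal:
  assumes "rels \<subseteq> carrier (free_group S)"
  shows "relator_closure S rels \<lhd> free_group S"
proof -
  interpret F: group "free_group S" by (rule group_free_group)
  let ?C = "{N. N \<lhd> free_group S \<and> rels \<subseteq> N}"
  have "carrier (free_group S) \<in> ?C" using assms F.normal_self by simp
  then have "subgroup (\<Inter>?C) (free_group S)"
    by (intro F.subgroups_Inter) (auto intro: normal_imp_subgroup)
  moreover have "x \<otimes>\<^bsub>free_group S\<^esub> h \<otimes>\<^bsub>free_group S\<^esub> inv\<^bsub>free_group S\<^esub> x \<in> \<Inter>?C"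
    if x: "x \<in> carrier (free_group S)" and h: "h \<in> \<Inter>?C" for x h
  proof (rule InterI)
    fix N assume N: "N \<in> ?C"
    then interpret normal N "free_group S" by simp
    show "x \<otimes>\<^bsub>free_group S\<^esub> h \<otimes>\<^bsub>free_group S\<^esub> inv\<^bsub>free_group S\<^esub> x \<in> N"
      using inv_op_closed2[OF x] N h by blast
  qed
  ultimately show ?thesis
    unfolding relator_closure_def F.normal_inv_iff by blast
qed

lemma presented_group_eq: "presented_group S rels = free_group S Mod relator_closure S rels"
  by (simp add: presented_group_def relator_closure_def)

lemma free_lift_group_hom:
  assumes "group G" "f \<in> S \<rightarrow> carrier G"
  shows "group_hom (free_group S) G (free_lift S G f)"
  by (rule group_homI[OF group_free_group assms(1) group.free_lift_hom[OF assms]])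

text \<open>
  Von Dyck's theorem. The kernel of the lift to the free group is one of the normal subgroups whose
  intersection is the relator closure, so the lift is constant on cosets.
\<close>

lemma presented_group_lift:
  assumes G: "group G" and f: "f \<in> S \<rightarrow> carrier G" and rels: "rels \<subseteq> carrier (free_group S)"
    and trivial: "\<And>r. r \<in> rels \<Longrightarrow> free_lift S G f r = \<one>\<^bsub>G\<^esub>"
  defines "L \<equiv> \<lambda>X. the_elem (free_lift S G f ` X)"
  shows presented_group_lift_coset: "w \<in> carrier (free_group S) \<Longrightarrow>
      L (relator_closure S rels #>\<^bsub>free_group S\<^esub> w) = free_lift S G f w"
    and presented_group_lift_hom: "L \<in> hom (presented_group S rels) G"
proof -
  interpret F: group "free_group S" by (rule group_free_group)
  interpret h: group_hom "free_group S" G "free_lift S G f"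
    by (rule free_lift_group_hom[OF G f])
  let ?N = "relator_closure S rels"
  interpret N: normal ?N "free_group S" by (rule relator_closure_normal[OF rels])
  have N_ker: "?N \<subseteq> kernel (free_group S) G (free_lift S G f)"
    unfolding relator_closure_def
    by (rule Inter_lower) (use h.normal_kernel rels trivial in \<open>auto simp: kernel_def\<close>)
  show coset: "L (?N #>\<^bsub>free_group S\<^esub> w) = free_lift S G f w" if w: "w \<in> carrier (free_group S)" for w
  proof -
    have "free_lift S G f x = free_lift S G f w" if "x \<in> ?N #>\<^bsub>free_group S\<^esub> w" for x
    proof -
      have "\<exists>u\<in>?N. x = u \<otimes>\<^bsub>free_group S\<^esub> w"
        using that by (simp add: r_coset_def)
      then obtain u where u: "u \<in> ?N" "x = u \<otimes>\<^bsub>free_group S\<^esub> w"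
        by (elim bexE)
      then have "u \<in> carrier (free_group S)" "free_lift S G f u = \<one>\<^bsub>G\<^esub>"
        using subsetD[OF N_ker u(1)] by (simp_all add: kernel_def)
      then show ?thesis
        using u w h.hom_mult[of u w] by simp
    qed
    moreover have "w \<in> ?N #>\<^bsub>free_group S\<^esub> w"
      using F.rcos_self[OF w N.subgroup_axioms] .
    ultimately have "free_lift S G f ` (?N #>\<^bsub>free_group S\<^esub> w) = {free_lift S G f w}" by blast
    then show ?thesis by (simp add: L_def)
  qed
  obtain g where g: "g \<in> hom (free_group S Mod ?N) G"
    and g_coset: "\<And>x. x \<in> carrier (free_group S) \<Longrightarrow> g (?N #>\<^bsub>free_group S\<^esub> x) = free_lift S G f x"
    using h.FactGroup_universal_kernel[OF N.normal_axioms N_ker] by metis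
  have "g X = L X" if "X \<in> carrier (free_group S Mod ?N)" for X
    using that g_coset coset by (auto simp: carrier_FactGroup)
  then show "L \<in> hom (presented_group S rels) G"
    unfolding presented_group_eq
    by (intro group.hom_restrict[OF N.factorgroup_is_group g])
qed

lemma braid_relators_closed: "braid_relators n \<subseteq> carrier (free_group {1..<n})"
  by (auto simp: braid_relators_def diff_conv_add_uminus simp del: add_uminus_conv_diff)

lemma group_braid_group: "group (braid_group n)"
  unfolding braid_group_def presented_group_eq
  by (rule normal.factorgroup_is_group[OF relator_closure_normal[OF braid_relators_closed]])

lemma braid_group_elem:
  assumes "p \<in> carrier (braid_group n)"
  obtains w where "w \<in> carrier (free_group {1..<n})"
    "p = relator_closure {1..<n} (braid_relators n) #>\<^bsub>free_group {1..<n}\<^esub> w"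
  using assms by (auto simp: braid_group_def presented_group_eq carrier_FactGroup)

text \<open>
  Stated as equations in the target group, these can be checked for automorphisms and permutations
  without computing the values of relators.
\<close>

definition braid_relations :: "nat \<Rightarrow> ('b, 'c) monoid_scheme \<Rightarrow> (nat \<Rightarrow> 'b) \<Rightarrow> bool"
  where "braid_relations n G f \<longleftrightarrow>
    (\<forall>i. i \<in> {1..<n} \<and> i + 1 \<in> {1..<n} \<longrightarrow>
      f i \<otimes>\<^bsub>G\<^esub> f (i + 1) \<otimes>\<^bsub>G\<^esub> f i = f (i + 1) \<otimes>\<^bsub>G\<^esub> f i \<otimes>\<^bsub>G\<^esub> f (i + 1)) \<and>
    (\<forall>i j. i \<in> {1..<n} \<and> j \<in> {1..<n} \<and> (i + 2 \<le> j \<or> j + 2 \<le> i) \<longrightarrow>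
      f i \<otimes>\<^bsub>G\<^esub> f j = f j \<otimes>\<^bsub>G\<^esub> f i)"

lemma braid_relations_imp_trivial:
  assumes G: "group G" and f: "f \<in> {1..<n} \<rightarrow> carrier G" and rel: "braid_relations n G f"
    and r: "r \<in> braid_relators n"
  shows "free_lift {1..<n} G f r = \<one>\<^bsub>G\<^esub>"
proof -
  interpret h: group_hom "free_group {1..<n}" G "free_lift {1..<n} G f"
    by (rule free_lift_group_hom[OF G f])
  note gen = group.free_lift_gen[OF G f]
  have add: "free_lift {1..<n} G f (u + v) = free_lift {1..<n} G f u \<otimes>\<^bsub>G\<^esub> free_lift {1..<n} G f v"
    if "u \<in> carrier (free_group {1..<n})" "v \<in> carrier (free_group {1..<n})" for u v
    using h.hom_mult[OF that] by simp
  have diff: "free_lift {1..<n} G f (u - v) = \<one>\<^bsub>G\<^esub>"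
    if "u \<in> carrier (free_group {1..<n})" "v \<in> carrier (free_group {1..<n})"
      "free_lift {1..<n} G f u = free_lift {1..<n} G f v" for u v
    using h.hom_mult[of u "- v"] h.hom_inv[OF that(2)] that by simp
  consider i where "i \<in> {1..<n}" "i + 1 \<in> {1..<n}"
      "r = (gen i + gen (i + 1) + gen i) - (gen (i + 1) + gen i + gen (i + 1))"
    | i j where "i \<in> {1..<n}" "j \<in> {1..<n}" "i + 2 \<le> j \<or> j + 2 \<le> i"
      "r = (gen i + gen j) - (gen j + gen i)"
    using r unfolding braid_relators_def by blast
  then show ?thesis
  proof cases
    case 1
    moreover have "f i \<otimes>\<^bsub>G\<^esub> f (i + 1) \<otimes>\<^bsub>G\<^esub> f i = f (i + 1) \<otimes>\<^bsub>G\<^esub> f i \<otimes>\<^bsub>G\<^esub> f (i + 1)"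
      using rel 1(1,2) unfolding braid_relations_def by blast
    ultimately show ?thesis
      unfolding 1(3) by (intro diff) (simp_all only: add gen add_in_free_group gen_in_free_group)
  next
    case 2
    moreover have "f i \<otimes>\<^bsub>G\<^esub> f j = f j \<otimes>\<^bsub>G\<^esub> f i"
      using rel 2(1-3) unfolding braid_relations_def by blast
    ultimately show ?thesis
      unfolding 2(4) by (intro diff) (simp_all only: add gen add_in_free_group gen_in_free_group)
  qed
qed

lemma braid_lift:
  assumes G: "group G" and f: "f \<in> {1..<n} \<rightarrow> carrier G" and rel: "braid_relations n G f"
  shows braid_lift_coset: "w \<in> carrier (free_group {1..<n}) \<Longrightarrow>
      braid_lift n G f (relator_closure {1..<n} (braid_relators n) #>\<^bsub>free_group {1..<n}\<^esub> w)
        = free_lift {1..<n} G f w"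
    and braid_lift_hom: "braid_lift n G f \<in> hom (braid_group n) G"
proof -
  note trivial = braid_relations_imp_trivial[OF G f rel]
  show "w \<in> carrier (free_group {1..<n}) \<Longrightarrow>
      braid_lift n G f (relator_closure {1..<n} (braid_relators n) #>\<^bsub>free_group {1..<n}\<^esub> w)
        = free_lift {1..<n} G f w"
    unfolding braid_lift_def by (rule presented_group_lift_coset[OF G f braid_relators_closed trivial])
  show "braid_lift n G f \<in> hom (braid_group n) G"
    unfolding braid_lift_def braid_group_def
    by (rule presented_group_lift_hom[OF G f braid_relators_closed trivial])
qed

section \<open>The Artin action and pure braids\<close>

lemma free_endomorphism:
  assumes "\<And>l. l \<in> S \<Longrightarrow> f l \<in> carrier (free_group T)"
  shows free_endomorphism_hom: "free_lift S (free_group T) f \<in> hom (free_group S) (free_group T)"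
    and free_endomorphism_gen: "l \<in> S \<Longrightarrow> free_lift S (free_group T) f (gen l) = f l"
    and free_endomorphism_extensional: "free_lift S (free_group T) f \<in> extensional (carrier (free_group S))"
proof -
  have f: "f \<in> S \<rightarrow> carrier (free_group T)" using assms by blast
  show "free_lift S (free_group T) f \<in> hom (free_group S) (free_group T)"
    by (rule group.free_lift_hom[OF group_free_group f])
  show "l \<in> S \<Longrightarrow> free_lift S (free_group T) f (gen l) = f l"
    by (rule group.free_lift_gen[OF group_free_group f])
  show "free_lift S (free_group T) f \<in> extensional (carrier (free_group S))"
    by (rule group.free_lift_extensional[OF group_free_group f])
qed

text \<open>
  The explicit inverse that witnesses the bijectivity of \<open>\<sigma>\<^sub>i\<close>.
\<close>

definition sigma_inv :: "nat \<Rightarrow> nat \<Rightarrow> (nat fgroup \<Rightarrow> nat fgroup)"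
  where "sigma_inv n i = free_lift {1..n} (F n)
    (\<lambda>l. if l = i then gen (i + 1)
         else if l = i + 1 then - gen (i + 1) + gen i + gen (i + 1)
         else gen l)"

lemma sigma:
  assumes "i \<in> {1..<n}"
  shows sigma_hom: "sigma n i \<in> hom (F n) (F n)"
    and sigma_extensional: "sigma n i \<in> extensional (carrier (F n))"
    and sigma_gen: "l \<in> {1..n} \<Longrightarrow> sigma n i (gen l) =
      (if l = i then gen i + gen (i + 1) - gen i else if l = i + 1 then gen i else gen l)"
    and sigma_inv_hom: "sigma_inv n i \<in> hom (F n) (F n)"
    and sigma_inv_gen: "l \<in> {1..n} \<Longrightarrow> sigma_inv n i (gen l) =
      (if l = i then gen (i + 1)
       else if l = i + 1 then - gen (i + 1) + gen i + gen (i + 1) else gen l)"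
proof -
  have s: "(if l = i then gen i + gen (i + 1) - gen i else if l = i + 1 then gen i else gen l)
      \<in> carrier (F n)"
    and t: "(if l = i then gen (i + 1) else if l = i + 1 then - gen (i + 1) + gen i + gen (i + 1)
      else gen l) \<in> carrier (F n)" if "l \<in> {1..n}" for l
    using assms that by auto
  show "sigma n i \<in> hom (F n) (F n)" "sigma n i \<in> extensional (carrier (F n))"
    unfolding sigma_def
    by (rule free_endomorphism_hom[OF s] free_endomorphism_extensional[OF s]; assumption)+
  show "sigma_inv n i \<in> hom (F n) (F n)"
    unfolding sigma_inv_def by (rule free_endomorphism_hom[OF t])
  show "l \<in> {1..n} \<Longrightarrow> sigma n i (gen l) =
      (if l = i then gen i + gen (i + 1) - gen i else if l = i + 1 then gen i else gen l)"
    unfolding sigma_def by (rule free_endomorphism_gen[OF s])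
  show "l \<in> {1..n} \<Longrightarrow> sigma_inv n i (gen l) =
      (if l = i then gen (i + 1)
       else if l = i + 1 then - gen (i + 1) + gen i + gen (i + 1) else gen l)"
    unfolding sigma_inv_def by (rule free_endomorphism_gen[OF t])
qed

lemma sigma_simps:
  assumes "i \<in> {1..<n}"
  shows "w \<in> carrier (F n) \<Longrightarrow> sigma n i w \<in> carrier (F n)"
    and "u \<in> carrier (F n) \<Longrightarrow> v \<in> carrier (F n) \<Longrightarrow> sigma n i (u + v) = sigma n i u + sigma n i v"
    and "w \<in> carrier (F n) \<Longrightarrow> sigma n i (- w) = - sigma n i w"
    and "w \<in> carrier (F n) \<Longrightarrow> sigma_inv n i w \<in> carrier (F n)"
    and "u \<in> carrier (F n) \<Longrightarrow> v \<in> carrier (F n) \<Longrightarrow>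
      sigma_inv n i (u + v) = sigma_inv n i u + sigma_inv n i v"
    and "w \<in> carrier (F n) \<Longrightarrow> sigma_inv n i (- w) = - sigma_inv n i w"
  by (fact free_group_hom_simps(1,2,4)[OF sigma_hom[OF assms]]
      free_group_hom_simps(1,2,4)[OF sigma_inv_hom[OF assms]])+

lemma sigma_in_Aut_F:
  assumes i: "i \<in> {1..<n}" shows "sigma n i \<in> carrier (Aut_F n)"
proof -
  note simps = sigma_simps[OF i] sigma_gen[OF i] sigma_inv_gen[OF i]
  interpret F: group "F n" by (rule group_free_group)
  have id: "(\<lambda>x\<in>carrier (F n). x) \<in> hom (F n) (F n)"
    using F.id_in_auto by (simp add: auto_def)
  have ii: "i \<in> {1..n}" "i + 1 \<in> {1..n}" using i by auto
  have left: "compose (carrier (F n)) (sigma_inv n i) (sigma n i) w = (\<lambda>x\<in>carrier (F n). x) w"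
    if "w \<in> carrier (F n)" for w
  proof (rule free_group_hom_eqI[OF F.hom_compose[OF sigma_hom[OF i] sigma_inv_hom[OF i]] id _ that])
    fix l assume "l \<in> {1..n}"
    then show "compose (carrier (F n)) (sigma_inv n i) (sigma n i) (gen l) = (\<lambda>x\<in>carrier (F n). x) (gen l)"
      using ii by (simp add: compose_def simps free_group_normalize del: add_uminus_conv_diff)
  qed
  have right: "compose (carrier (F n)) (sigma n i) (sigma_inv n i) w = (\<lambda>x\<in>carrier (F n). x) w"
    if "w \<in> carrier (F n)" for w
  proof (rule free_group_hom_eqI[OF F.hom_compose[OF sigma_inv_hom[OF i] sigma_hom[OF i]] id _ that])
    fix l assume "l \<in> {1..n}"
    then show "compose (carrier (F n)) (sigma n i) (sigma_inv n i) (gen l) = (\<lambda>x\<in>carrier (F n). x) (gen l)"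
      using ii by (simp add: compose_def simps free_group_normalize del: add_uminus_conv_diff)
  qed
  have "bij_betw (sigma n i) (carrier (F n)) (carrier (F n))"
    using left right simps(1,4)
    by (intro bij_betw_byWitness[where f' = "sigma_inv n i"]) (auto simp: compose_def)
  then show ?thesis
    using sigma_hom[OF i] sigma_extensional[OF i] by (simp add: carrier_Aut_F auto_def Bij_def)
qed

text \<open>
  Two automorphisms agree if they agree on generators. In the first relation both sides send \<open>x\<^sub>i\<close> to
  the conjugate \<open>x\<^sub>i x\<^bsub>i+1\<^esub> x\<^bsub>i+2\<^esub> x\<^bsub>i+1\<^esub>\<^sup>-\<^sup>1 x\<^sub>i\<^sup>-\<^sup>1\<close>, \<open>x\<^bsub>i+1\<^esub>\<close> to \<open>x\<^sub>i x\<^bsub>i+1\<^esub> x\<^sub>i\<^sup>-\<^sup>1\<close> and \<open>x\<^bsub>i+2\<^esub>\<close> to \<open>x\<^sub>i\<close>.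
\<close>

lemma sigma_braid_relations: "braid_relations n (Aut_F n) (sigma n)"
  unfolding braid_relations_def
proof (intro conjI allI impI)
  interpret A: group "Aut_F n" by (rule group_Aut_F)
  fix i assume "i \<in> {1..<n} \<and> i + 1 \<in> {1..<n}"
  then have i: "i \<in> {1..<n}" "i + 1 \<in> {1..<n}" by auto
  note simps = sigma_simps[OF i(1)] sigma_gen[OF i(1)] sigma_simps[OF i(2)] sigma_gen[OF i(2)]
  show "sigma n i \<otimes>\<^bsub>Aut_F n\<^esub> sigma n (i + 1) \<otimes>\<^bsub>Aut_F n\<^esub> sigma n i =
    sigma n (i + 1) \<otimes>\<^bsub>Aut_F n\<^esub> sigma n i \<otimes>\<^bsub>Aut_F n\<^esub> sigma n (i + 1)"
  proof (rule Aut_F_eqI)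
    fix l assume l: "l \<in> {1..n}"
    have ii: "i \<in> {1..n}" "i + 1 \<in> {1..n}" "i + 1 + 1 \<in> {1..n}" using i by auto
    show "(sigma n i \<otimes>\<^bsub>Aut_F n\<^esub> sigma n (i + 1) \<otimes>\<^bsub>Aut_F n\<^esub> sigma n i) (gen l) =
      (sigma n (i + 1) \<otimes>\<^bsub>Aut_F n\<^esub> sigma n i \<otimes>\<^bsub>Aut_F n\<^esub> sigma n (i + 1)) (gen l)"
      using l ii
      by (simp add: compose_def simps free_group_normalize del: add_uminus_conv_diff Suc_eq_plus1)
  qed (intro A.m_closed sigma_in_Aut_F i)+
next
  interpret A: group "Aut_F n" by (rule group_Aut_F)
  fix i j assume "i \<in> {1..<n} \<and> j \<in> {1..<n} \<and> (i + 2 \<le> j \<or> j + 2 \<le> i)"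
  then have ij: "i \<in> {1..<n}" "j \<in> {1..<n}" and far: "i + 2 \<le> j \<or> j + 2 \<le> i" by auto
  note simps = sigma_simps[OF ij(1)] sigma_gen[OF ij(1)] sigma_simps[OF ij(2)] sigma_gen[OF ij(2)]
  show "sigma n i \<otimes>\<^bsub>Aut_F n\<^esub> sigma n j = sigma n j \<otimes>\<^bsub>Aut_F n\<^esub> sigma n i"
  proof (rule Aut_F_eqI)
    fix l assume l: "l \<in> {1..n}"
    have ii: "i \<in> {1..n}" "i + 1 \<in> {1..n}" "j \<in> {1..n}" "j + 1 \<in> {1..n}"
      "i \<noteq> j" "i + 1 \<noteq> j" "j + 1 \<noteq> i" using ij far by auto
    then show "(sigma n i \<otimes>\<^bsub>Aut_F n\<^esub> sigma n j) (gen l) = (sigma n j \<otimes>\<^bsub>Aut_F n\<^esub> sigma n i) (gen l)"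
      using l by (simp add: compose_def simps free_group_normalize del: add_uminus_conv_diff Suc_eq_plus1)
  qed (intro A.m_closed sigma_in_Aut_F ij)+
qed

lemma transpose_braid_relations: "braid_relations n (sym_group n) (\<lambda>i. transpose i (i + 1))"
  by (auto simp: braid_relations_def sym_group_mult fun_eq_iff transpose_def)

lemma transpose_in_sym_group: "i \<in> {1..<n} \<Longrightarrow> transpose i (i + 1) \<in> carrier (sym_group n)"
  by (simp add: sym_group_carrier permutes_swap_id)

lemma sigma_perm_conj:
  assumes i: "i \<in> {1..<n}" shows "(sigma n i, transpose i (i + 1)) \<in> perm_conj n"
proof -
  have "\<exists>f\<in>carrier (F n). sigma n i (gen (transpose i (i + 1) l)) = - f + gen l + f"
    if l: "l \<in> {1..n}" for l
  proof (cases "l = i + 1")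
    case True
    then show ?thesis
      \<comment> \<open>the transposition sends \<open>i + 1\<close> to \<open>i\<close>, and \<open>\<sigma>\<^sub>i x\<^sub>i = x\<^sub>i x\<^bsub>i+1\<^esub> x\<^sub>i\<^sup>-\<^sup>1\<close>\<close>
      using i by (intro bexI[of _ "- gen i"]) (auto simp: sigma_gen)
  next
    case False
    then show ?thesis
      using i l by (intro bexI[of _ 0]) (auto simp: sigma_gen transpose_def)
  qed
  then show ?thesis
    using sigma_in_Aut_F[OF i] transpose_in_sym_group[OF i] by (simp add: perm_conj_def sym_group_carrier)
qed

text \<open>
  A pair of homomorphisms maps a word into a subgroup of the product once it does so on generators.
\<close>

lemma free_lift_perm_conj:
  assumes "w \<in> carrier (free_group {1..<n})"
  shows "(free_lift {1..<n} (Aut_F n) (sigma n) w,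
    free_lift {1..<n} (sym_group n) (\<lambda>i. transpose i (i + 1)) w) \<in> perm_conj n"
proof -
  let ?\<alpha> = "free_lift {1..<n} (Aut_F n) (sigma n)"
    and ?\<pi> = "free_lift {1..<n} (sym_group n) (\<lambda>i. transpose i (i + 1))"
  have f: "sigma n \<in> {1..<n} \<rightarrow> carrier (Aut_F n)" using sigma_in_Aut_F by blast
  have g: "(\<lambda>i. transpose i (i + 1)) \<in> {1..<n} \<rightarrow> carrier (sym_group n)"
    using transpose_in_sym_group by blast
  interpret \<alpha>: group_hom "free_group {1..<n}" "Aut_F n" ?\<alpha>
    by (rule free_lift_group_hom[OF group_Aut_F f])
  interpret \<pi>: group_hom "free_group {1..<n}" "sym_group n" ?\<pi>
    by (rule free_lift_group_hom[OF sym_group_is_group g])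
  interpret K: subgroup "perm_conj n" "Aut_F n \<times>\<times> sym_group n" by (rule subgroup_perm_conj)
  have mult: "(?\<alpha> (v + u), ?\<pi> (v + u)) \<in> perm_conj n"
    if "v \<in> carrier (free_group {1..<n})" "(?\<alpha> v, ?\<pi> v) \<in> perm_conj n"
      "u \<in> carrier (free_group {1..<n})" "(?\<alpha> u, ?\<pi> u) \<in> perm_conj n" for u v
    using K.m_closed[OF that(2,4)] \<alpha>.hom_mult[OF that(1,3)] \<pi>.hom_mult[OF that(1,3)]
    by simp
  have P_gen: "(?\<alpha> (gen i), ?\<pi> (gen i)) \<in> perm_conj n" if "i \<in> {1..<n}" for i
    using sigma_perm_conj[OF that] group.free_lift_gen[OF group_Aut_F f that]
      group.free_lift_gen[OF sym_group_is_group g that] by simp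
  have P_inv: "(?\<alpha> (- gen i), ?\<pi> (- gen i)) \<in> perm_conj n" if i: "i \<in> {1..<n}" for i
  proof -
    have gi: "gen i \<in> carrier (free_group {1..<n})" using i by simp
    have "(inv\<^bsub>Aut_F n\<^esub> ?\<alpha> (gen i), inv\<^bsub>sym_group n\<^esub> ?\<pi> (gen i)) \<in> perm_conj n"
      using K.m_inv_closed[OF P_gen[OF i]]
        inv_DirProd[OF group_Aut_F sym_group_is_group \<alpha>.hom_closed[OF gi] \<pi>.hom_closed[OF gi]]
      by simp
    then show ?thesis
      using \<alpha>.hom_inv[OF gi] \<pi>.hom_inv[OF gi] inv_free_group[OF gi] by simp
  qed
  show ?thesis
    using assms
  proof (induction w rule: free_group_induct)
    case zero
    show ?case using K.one_closed \<alpha>.hom_one \<pi>.hom_one by (simp only: one_DirProd one_free_group)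
  next
    case (gen i u) then show ?case by (intro mult P_gen) simp_all
  next
    case (inv i u) then show ?case by (intro mult P_inv) simp_all
  qed
qed

lemma artin_hom: "artin n \<in> hom (braid_group n) (Aut_F n)"
  and artin_coset: "w \<in> carrier (free_group {1..<n}) \<Longrightarrow>
    artin n (relator_closure {1..<n} (braid_relators n) #>\<^bsub>free_group {1..<n}\<^esub> w)
      = free_lift {1..<n} (Aut_F n) (sigma n) w"
proof -
  have f: "sigma n \<in> {1..<n} \<rightarrow> carrier (Aut_F n)" using sigma_in_Aut_F by blast
  note * = braid_lift[OF group_Aut_F f sigma_braid_relations, folded artin_def]
  show "artin n \<in> hom (braid_group n) (Aut_F n)"
    "w \<in> carrier (free_group {1..<n}) \<Longrightarrow>
    artin n (relator_closure {1..<n} (braid_relators n) #>\<^bsub>free_group {1..<n}\<^esub> w)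
      = free_lift {1..<n} (Aut_F n) (sigma n) w"
    by (fact *)+
qed

lemma braid_perm_hom: "braid_perm n \<in> hom (braid_group n) (sym_group n)"
  and braid_perm_coset: "w \<in> carrier (free_group {1..<n}) \<Longrightarrow>
    braid_perm n (relator_closure {1..<n} (braid_relators n) #>\<^bsub>free_group {1..<n}\<^esub> w)
      = free_lift {1..<n} (sym_group n) (\<lambda>i. transpose i (i + 1)) w"
proof -
  have f: "(\<lambda>i. transpose i (i + 1)) \<in> {1..<n} \<rightarrow> carrier (sym_group n)"
    using transpose_in_sym_group by blast
  note * = braid_lift[OF sym_group_is_group f transpose_braid_relations, folded braid_perm_def]
  show "braid_perm n \<in> hom (braid_group n) (sym_group n)"
    "w \<in> carrier (free_group {1..<n}) \<Longrightarrow>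
    braid_perm n (relator_closure {1..<n} (braid_relators n) #>\<^bsub>free_group {1..<n}\<^esub> w)
      = free_lift {1..<n} (sym_group n) (\<lambda>i. transpose i (i + 1)) w"
    by (fact *)+
qed

lemma artin_perm_conj:
  assumes "p \<in> carrier (braid_group n)" shows "(artin n p, braid_perm n p) \<in> perm_conj n"
  using assms
proof (rule braid_group_elem)
  fix w assume "w \<in> carrier (free_group {1..<n})"
    "p = relator_closure {1..<n} (braid_relators n) #>\<^bsub>free_group {1..<n}\<^esub> w"
  then show ?thesis
    using free_lift_perm_conj[of w n] by (simp add: artin_coset braid_perm_coset)
qed

lemma pure_braid_group_iff:
  "p \<in> carrier (pure_braid_group n) \<longleftrightarrow> p \<in> carrier (braid_group n) \<and> braid_perm n p = id"
  by (simp add: pure_braid_group_def kernel_def sym_group_one)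

lemma mult_pure_braid_group: "mult (pure_braid_group n) = mult (braid_group n)"
  by (simp add: pure_braid_group_def)

lemma group_pure_braid_group: "group (pure_braid_group n)"
proof -
  interpret group_hom "braid_group n" "sym_group n" "braid_perm n"
    by (rule group_homI[OF group_braid_group sym_group_is_group braid_perm_hom])
  show ?thesis
    unfolding pure_braid_group_def
    by (rule subgroup.subgroup_is_group[OF subgroup_kernel group_braid_group])
qed

lemma artin_pure_in_Cb: "p \<in> carrier (pure_braid_group n) \<Longrightarrow> artin n p \<in> carrier (Cb n)"
  using artin_perm_conj[of p n] by (simp add: Cb_iff_perm_conj pure_braid_group_iff)

lemma artin_group_hom: "group_hom (pure_braid_group n) (Cb n) (artin n)"
proof (rule group_homI[OF group_pure_braid_group group_Cb homI])
  show "p \<in> carrier (pure_braid_group n) \<Longrightarrow> artin n p \<in> carrier (Cb n)" for p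
    by (rule artin_pure_in_Cb)
  show "artin n (p \<otimes>\<^bsub>pure_braid_group n\<^esub> q) = artin n p \<otimes>\<^bsub>Cb n\<^esub> artin n q"
    if "p \<in> carrier (pure_braid_group n)" "q \<in> carrier (pure_braid_group n)" for p q
    using hom_mult[OF artin_hom[of n], of p q] that
    by (simp add: mult_pure_braid_group mult_Cb pure_braid_group_iff del: mult_Aut_F)
qed

lemma gassner_hat_artin:
  assumes "p \<in> carrier (pure_braid_group n)" shows "gassner_hat n (artin n p) = gassner n p"
  using assms gassner_hat_eq[OF artin_pure_in_Cb[OF assms]] by (simp add: gassner_def)

text \<open>
  The Gassner representation is the composition of the Artin action with \<open>gassner_hat n\<close>, from which
  it inherits multiplicativity.
\<close>

lemma gassner_group_hom: "group_hom (pure_braid_group n) (GL n) (gassner n)"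
proof (rule group_homI[OF group_pure_braid_group group_GL])
  have "gassner_hat n \<circ> artin n \<in> hom (pure_braid_group n) (GL n)"
    using hom_compose[OF group_hom.homh[OF artin_group_hom] group_hom.homh[OF gassner_hat_group_hom]] .
  then show "gassner n \<in> hom (pure_braid_group n) (GL n)"
    by (rule group.hom_restrict[OF group_pure_braid_group]) (simp add: gassner_hat_artin)
qed

theorem theorem1:
  fixes n :: nat
  assumes "n \<ge> 2"
  shows "group_hom (Cb n) (GL n) (gassner_hat n)
    \<and> group_hom (pure_braid_group n) (GL n) (gassner n)
    \<and> group_hom (pure_braid_group n) (Cb n) (artin n)
    \<and> (\<forall>p\<in>carrier (pure_braid_group n). gassner_hat n (artin n p) = gassner n p)"
  using gassner_hat_group_hom gassner_group_hom artin_group_hom gassner_hat_artin by blast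


end
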